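(* Let $q_1,q_2,q_3,q_{f1},q_{f2}\in\mathbb{N}_0$ and $q:=\min(q_1,q_2,q_3)$. Let $\{\eta_1^{(i)}\}_{i=0}^{q_1}\subset[-1,1]$, $\{\eta_2^{(i)}\}_{i=0}^{q_2}\subset[-1,1)$, $\{\eta_3^{(i)}\}_{i=0}^{q_3}\subset[-1,1)$ be the (distinct) nodes, and $\{\omega_m^{(i)}\}_{i=0}^{q_m}\subset(0,\infty)$, $m\in\{1,2,3\}$, the weights, of one-dimensional Gaussian quadrature rules, and let $\{\eta_{f1}^{(i)}\}_{i=0}^{q_{f1}},\{\eta_{f2}^{(i)}\}_{i=0}^{q_{f2}}\subset[-1,1]$ and $\{\omega_{f1}^{(i)}\}_{i=0}^{q_{f1}},\{\omega_{f2}^{(i)}\}_{i=0}^{q_{f2}}\subset[0,\infty)$ be the nodes and weights of one-dimensional facet quadrature rules. Say that a rule with nodes $\eta^{(i)}$ and weights $\omega^{(i)}$ satisfies $\tau^{(a,b)}\ge k$ if $\sum_iV(\eta^{(i)})\omega^{(i)}=\int_{-1}^1V(\eta)(1-\eta)^a(1+\eta)^b\,d\eta$ for all polynomials $V$ of degree at most $k$. Assume that the volume rules satisfy $$\tau_1^{(0,0)}\ge2q_1,\qquad \tau_2^{(0,0)}\ge2q_2+1,\qquad\text{and either}\quad \tau_3^{(0,0)}\ge2q_3+1\quad\text{or}\quad\tau_3^{(1,0)}\ge2q_3,$$ and that the facet rules satisfy $$\tau_{f1}^{(0,0)}\ge2\max(q_1,q_2),\qquad\text{and either}\quad\tau_{f2}^{(0,0)}\ge2\max(q_2,q_3)+1\quad\text{or}\quad\tau_{f2}^{(1,0)}\ge2\max(q_2,q_3).$$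 Then the matrices $D^{(1)},D^{(2)},D^{(3)}\in\mathbb{R}^{N_q\times N_q}$, $N_q=(q_1+1)(q_2+1)(q_3+1)$, given by $$D^{(1)}_{\sigma(\boldsymbol\alpha)\sigma(\boldsymbol\beta)}=\frac{4}{(1-\eta_2^{(\alpha_2)})(1-\eta_3^{(\alpha_3)})}\frac{d\ell_1^{(\beta_1)}}{d\eta_1}(\eta_1^{(\alpha_1)})\,\delta_{\alpha_2\beta_2}\delta_{\alpha_3\beta_3},$$ $$D^{(2)}_{\sigma(\boldsymbol\alpha)\sigma(\boldsymbol\beta)}=\frac{2(1+\eta_1^{(\alpha_1)})}{(1-\eta_2^{(\alpha_2)})(1-\eta_3^{(\alpha_3)})}\frac{d\ell_1^{(\beta_1)}}{d\eta_1}(\eta_1^{(\alpha_1)})\,\delta_{\alpha_2\beta_2}\delta_{\alpha_3\beta_3}+\frac{2}{1-\eta_3^{(\alpha_3)}}\,\delta_{\alpha_1\beta_1}\frac{d\ell_2^{(\beta_2)}}{d\eta_2}(\eta_2^{(\alpha_2)})\,\delta_{\alpha_3\beta_3},$$ $$D^{(3)}_{\sigma(\boldsymbol\alpha)\sigma(\boldsymbol\beta)}=\frac{2(1+\eta_1^{(\alpha_1)})}{(1-\eta_2^{(\alpha_2)})(1-\eta_3^{(\alpha_3)})}\frac{d\ell_1^{(\beta_1)}}{d\eta_1}(\eta_1^{(\alpha_1)})\,\delta_{\alpha_2\beta_2}\delta_{\alpha_3\beta_3}+\frac{1+\eta_2^{(\alpha_2)}}{1-\eta_3^{(\alpha_3)}}\,\delta_{\alpha_1\beta_1}\frac{d\ell_2^{(\beta_2)}}{d\eta_2}(\eta_2^{(\alpha_2)})\,\delta_{\alpha_3\beta_3}+\delta_{\alpha_1\beta_1}\delta_{\alpha_2\beta_2}\frac{d\ell_3^{(\beta_3)}}{d\eta_3}(\eta_3^{(\alpha_3)}),$$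 are diagonal-norm nodal SBP operators of degree $q$ on the reference tetrahedron $\hat\Omega$, approximating $\partial/\partial\xi_1,\partial/\partial\xi_2,\partial/\partial\xi_3$ respectively, with respect to the nodes $\boldsymbol\xi^{(\sigma(\boldsymbol\alpha))}=\boldsymbol\chi(\eta_1^{(\alpha_1)},\eta_2^{(\alpha_2)},\eta_3^{(\alpha_3)})$ and the diagonal norm matrix $W$ with $W_{ij}=\omega^{(i)}\delta_{ij}$ (weights $\omega^{(i)}$ as in the context), and with boundary operators $$E^{(m)}=\sum_{\zeta=1}^{4}\hat n_m^{(\zeta)}\,(R^{(\zeta)})^{\mathrm T}B^{(\zeta)}R^{(\zeta)},\qquad m\in\{1,2,3\},$$ where the matrices $R^{(\zeta)}$, which are interpolation/extrapolation operators of degree at least $q$, and the diagonal matrices $B^{(\zeta)}$ are those defined in the context.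
   Context: Notation. $\mathbb{P}_p(\mathcal D)$ is the space of polynomials of total degree at most $p$ on $\mathcal D$; $\mathbb{N}_0=\{0,1,2,\dots\}$; $\delta_{ij}$ is the Kronecker delta. Gaussian quadrature rules. The volume rule in direction $m$ is of Gauss, Gauss-Radau (one endpoint of $[-1,1]$ is a node) or Gauss-Lobatto (both endpoints are nodes) type for the Jacobi weight $(1-\eta)^{a_m}(1+\eta)^{b_m}$, with $q_m+1$ nodes and exact for polynomials of degree $2q_m+1$, $2q_m$, $2q_m-1$, respectively; here $(a_1,b_1)=(a_2,b_2)=(0,0)$ and $(a_3,b_3)\in\{(0,0),(1,0)\}$ according to which alternative is assumed for the third rule. Nodal SBP operator. Let $\hat\Omega\subset\mathbb{R}^d$ be compact and connected, with distinct nodes $\boldsymbol\xi^{(1)},\dots,\boldsymbol\xi^{(N_q)}\in\hat\Omega$ and outward unit normal $\hat{\boldsymbol n}$ on $\partial\hat\Omega$. For functions $U,V:\hat\Omega\to\mathbb{R}$ let $\underline u=[U(\boldsymbol\xi^{(1)}),\dots,U(\boldsymbol\xi^{(N_q)})]^{\mathrm T}$ and $\underline v=[V(\boldsymbol\xi^{(1)}),\dots,V(\boldsymbol\xi^{(N_q)})]^{\mathrm T}$. A matrix $D^{(m)}\in\mathbb{R}^{N_q\times N_q}$ approximating $\partial/\partial\xi_m$ is a nodal SBP operator of degree $p\in\mathbb{N}_0$ if (i) $D^{(m)}\underline v=[(\partial V/\partial\xi_m)(\boldsymbol\xi^{(1)}),\dots,(\partial V/\partial\xi_m)(\boldsymbol\xi^{(N_q)})]^{\mathrm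 T}$ for all $V\in\mathbb{P}_p(\hat\Omega)$; (ii) $D^{(m)}=W^{-1}Q^{(m)}$ with $W$ symmetric positive-definite and $Q^{(m)}+(Q^{(m)})^{\mathrm T}=E^{(m)}$; (iii) for some $r\ge p$, $\underline u^{\mathrm T}E^{(m)}\underline v=\int_{\partial\hat\Omega}U(\boldsymbol\xi)V(\boldsymbol\xi)\hat n_m(\boldsymbol\xi)\,d\hat s$ for all $U,V\in\mathbb{P}_r(\hat\Omega)$. It is diagonal-norm if $W$ is diagonal. $E^{(m)}$ is called the boundary operator. Reference tetrahedron. $\hat\Omega=\{\boldsymbol\xi\in[-1,1]^3:\xi_1+\xi_2+\xi_3\le-1\}$, with facets $\hat\Gamma^{(1)}=\{\boldsymbol\xi\in\hat\Omega:\xi_2=-1\}$, $\hat\Gamma^{(2)}=\{\boldsymbol\xi\in\hat\Omega:\xi_1+\xi_2+\xi_3=-1\}$, $\hat\Gamma^{(3)}=\{\boldsymbol\xi\in\hat\Omega:\xi_1=-1\}$, $\hat\Gamma^{(4)}=\{\boldsymbol\xi\in\hat\Omega:\xi_3=-1\}$ and outward unit normals $\hat{\boldsymbol n}^{(1)}=[0,-1,0]^{\mathrm T}$, $\hat{\boldsymbol n}^{(2)}=[1/\sqrt3,1/\sqrt3,1/\sqrt3]^{\mathrm T}$, $\hat{\boldsymbol n}^{(3)}=[-1,0,0]^{\mathrm T}$, $\hat{\boldsymbol n}^{(4)}=[0,0,-1]^{\mathrm T}$. The collapsed coordinate map $\boldsymbol\chi:[-1,1]^3\to\hat\Omega$ is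 $\boldsymbol\chi(\boldsymbol\eta)=[\tfrac14(1+\eta_1)(1-\eta_2)(1-\eta_3)-1,\ \tfrac12(1+\eta_2)(1-\eta_3)-1,\ \eta_3]^{\mathrm T}$. Lagrange bases and ordering. For $m\in\{1,2,3\}$ and $i\in\{0,\dots,q_m\}$, $\ell_m^{(i)}(\eta_m)=\prod_{j\in\{0,\dots,q_m\}\setminus\{i\}}\frac{\eta_m-\eta_m^{(j)}}{\eta_m^{(i)}-\eta_m^{(j)}}$. $\sigma:\{0,\dots,q_1\}\times\{0,\dots,q_2\}\times\{0,\dots,q_3\}\to\{1,\dots,N_q\}$ and $\sigma_f:\{0,\dots,q_{f1}\}\times\{0,\dots,q_{f2}\}\to\{1,\dots,N_f\}$, $N_f=(q_{f1}+1)(q_{f2}+1)$, are any bijections. Volume weights. If the alternative for the third rule is with respect to the weight exponents $(0,0)$, then $\omega^{(\sigma(\boldsymbol\alpha))}=\tfrac18(1-\eta_2^{(\alpha_2)})(1-\eta_3^{(\alpha_3)})^2\,\omega_1^{(\alpha_1)}\omega_2^{(\alpha_2)}\omega_3^{(\alpha_3)}$; if it is with respect to $(1,0)$, then $\omega^{(\sigma(\boldsymbol\alpha))}=\tfrac18(1-\eta_2^{(\alpha_2)})(1-\eta_3^{(\alpha_3)})\,\omega_1^{(\alpha_1)}\omega_2^{(\alpha_2)}\omega_3^{(\alpha_3)}$. Facet quadrature and facet operators. For $\boldsymbol\alpha=(\alpha_1,\alpha_2)$ the facet nodes are $\boldsymbol\xi^{(1,\sigma_f(\boldsymbol\alpha))}=\boldsymbol\chi(\eta_{f1}^{(\alpha_1)},-1,\eta_{f2}^{(\alpha_2)})$,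 $\boldsymbol\xi^{(2,\sigma_f(\boldsymbol\alpha))}=\boldsymbol\chi(1,\eta_{f1}^{(\alpha_1)},\eta_{f2}^{(\alpha_2)})$, $\boldsymbol\xi^{(3,\sigma_f(\boldsymbol\alpha))}=\boldsymbol\chi(-1,\eta_{f1}^{(\alpha_1)},\eta_{f2}^{(\alpha_2)})$, $\boldsymbol\xi^{(4,\sigma_f(\boldsymbol\alpha))}=\boldsymbol\chi(\eta_{f1}^{(\alpha_1)},\eta_{f2}^{(\alpha_2)},-1)$. The facet weights are $\omega^{(\zeta,\sigma_f(\boldsymbol\alpha))}=c_\zeta\,\tfrac12(1-\eta_{f2}^{(\alpha_2)})\,\omega_{f1}^{(\alpha_1)}\omega_{f2}^{(\alpha_2)}$ if the alternative for the second facet rule is with respect to $(0,0)$, and $\omega^{(\zeta,\sigma_f(\boldsymbol\alpha))}=c_\zeta\,\tfrac12\,\omega_{f1}^{(\alpha_1)}\omega_{f2}^{(\alpha_2)}$ if it is with respect to $(1,0)$, where $c_1=c_3=c_4=1$ and $c_2=\sqrt3$. $B^{(\zeta)}\in\mathbb{R}^{N_f\times N_f}$ is diagonal with $B^{(\zeta)}_{ij}=\omega^{(\zeta,i)}\delta_{ij}$. The matrices $R^{(\zeta)}\in\mathbb{R}^{N_f\times N_q}$ have entries $R^{(1)}_{\sigma_f(\boldsymbol\alpha)\sigma(\boldsymbol\beta)}=\ell_1^{(\beta_1)}(\eta_{f1}^{(\alpha_1)})\ell_2^{(\beta_2)}(-1)\ell_3^{(\beta_3)}(\eta_{f2}^{(\alpha_2)})$,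 $R^{(2)}_{\sigma_f(\boldsymbol\alpha)\sigma(\boldsymbol\beta)}=\ell_1^{(\beta_1)}(1)\ell_2^{(\beta_2)}(\eta_{f1}^{(\alpha_1)})\ell_3^{(\beta_3)}(\eta_{f2}^{(\alpha_2)})$, $R^{(3)}_{\sigma_f(\boldsymbol\alpha)\sigma(\boldsymbol\beta)}=\ell_1^{(\beta_1)}(-1)\ell_2^{(\beta_2)}(\eta_{f1}^{(\alpha_1)})\ell_3^{(\beta_3)}(\eta_{f2}^{(\alpha_2)})$, $R^{(4)}_{\sigma_f(\boldsymbol\alpha)\sigma(\boldsymbol\beta)}=\ell_1^{(\beta_1)}(\eta_{f1}^{(\alpha_1)})\ell_2^{(\beta_2)}(\eta_{f2}^{(\alpha_2)})\ell_3^{(\beta_3)}(-1)$. $R^{(\zeta)}$ is an interpolation/extrapolation operator of degree $r^{(\zeta)}$ if $R^{(\zeta)}\underline v=[V(\boldsymbol\xi^{(\zeta,1)}),\dots,V(\boldsymbol\xi^{(\zeta,N_f)})]^{\mathrm T}$ for all $V\in\mathbb{P}_{r^{(\zeta)}}(\hat\Omega)$. *)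

theory Defs
  imports "HOL-Analysis.Analysis" "HOL-Computational_Algebra.Polynomial"
begin

section \<open>One-dimensional quadrature rules and Lagrange bases\<close>

definition lagrange_basis :: "nat \<Rightarrow> (nat \<Rightarrow> real) \<Rightarrow> nat \<Rightarrow> real \<Rightarrow> real" where
  "lagrange_basis q \<eta> i x = (\<Prod>j\<in>{0..q} - {i}. (x - \<eta> j) / (\<eta> i - \<eta> j))"

text \<open>The rule with nodes \<open>\<eta> 0, \<dots>, \<eta> q\<close> and weights \<open>\<omega> 0, \<dots>, \<omega> q\<close> satisfies
  \<open>\<tau>\<^sup>(\<^sup>a\<^sup>,\<^sup>b\<^sup>) \<ge> k\<close>. Only the Jacobi exponents 0 and 1 occur, so \<open>a\<close> and \<open>b\<close> are natural.\<close>

definition quadrature_exact ::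
  "nat \<Rightarrow> nat \<Rightarrow> nat \<Rightarrow> nat \<Rightarrow> (nat \<Rightarrow> real) \<Rightarrow> (nat \<Rightarrow> real) \<Rightarrow> bool" where
  "quadrature_exact a b k q \<eta> \<omega> \<longleftrightarrow>
     (\<forall>V :: real poly. degree V \<le> k \<longrightarrow>
        (\<Sum>i=0..q. poly V (\<eta> i) * \<omega> i)
          = integral {-1..1} (\<lambda>x. poly V x * (1 - x) ^ a * (1 + x) ^ b))"

text \<open>The three disjuncts are the Gauss, Gauss-Radau and Gauss-Lobatto types. In the last one
  \<open>q \<ge> 1\<close> is automatic (both endpoints are nodes), so \<open>2 * q - 1\<close> does not truncate.\<close>

definition gaussian_rule ::
  "nat \<Rightarrow> nat \<Rightarrow> nat \<Rightarrow> (nat \<Rightarrow> real) \<Rightarrow> (nat \<Rightarrow> real) \<Rightarrow> bool" where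
  "gaussian_rule a b q \<eta> \<omega> \<longleftrightarrow>
     quadrature_exact a b (2 * q + 1) q \<eta> \<omega>
     \<or> ((-1 \<in> \<eta> ` {0..q} \<or> 1 \<in> \<eta> ` {0..q}) \<and> quadrature_exact a b (2 * q) q \<eta> \<omega>)
     \<or> (-1 \<in> \<eta> ` {0..q} \<and> 1 \<in> \<eta> ` {0..q} \<and> quadrature_exact a b (2 * q - 1) q \<eta> \<omega>)"


section \<open>Polynomials of total degree at most p\<close>

text \<open>Polynomials on a domain are represented by polynomial functions on the whole space; on a
  set with nonempty interior the extension is unique, and it makes partial derivatives at
  boundary nodes meaningful.\<close>

definition poly_space :: "nat \<Rightarrow> (real^'d \<Rightarrow> real) set" where
  "poly_space p =
     {V. \<exists>c :: ('d \<Rightarrow> nat) \<Rightarrow> real. \<forall>x.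
           V x = (\<Sum>k\<in>{k. (\<Sum>i\<in>UNIV. k i) \<le> p}. c k * (\<Prod>i\<in>UNIV. (x $ i) ^ k i))}"

definition partial_deriv :: "'d \<Rightarrow> (real^'d \<Rightarrow> real) \<Rightarrow> real^'d \<Rightarrow> real" where
  "partial_deriv m V x = deriv (\<lambda>t. V (x + t *\<^sub>R axis m 1)) 0"

definition nodal_values :: "('n \<Rightarrow> 'x) \<Rightarrow> ('x \<Rightarrow> real) \<Rightarrow> real^'n" where
  "nodal_values \<xi> V = (\<chi> i. V (\<xi> i))"


section \<open>Integration over the boundary of a polytope\<close>

text \<open>The integral of \<open>f\<close> over a set \<open>F\<close> lying in a plane, with respect to surface area: the
  two-dimensional Lebesgue measure is transported to the plane by an isometric
  parametrization. The value does not depend on which isometry is chosen.\<close>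

definition planar_integral :: "(real^3) set \<Rightarrow> (real^3 \<Rightarrow> real) \<Rightarrow> real" where
  "planar_integral F f =
     (let \<phi> = (SOME \<phi> :: real^2 \<Rightarrow> real^3.
                 (\<forall>u v. dist (\<phi> u) (\<phi> v) = dist u v) \<and> F \<subseteq> range \<phi>)
      in integral {u. \<phi> u \<in> F} (\<lambda>u. f (\<phi> u)))"

text \<open>The normal is unique if \<open>F\<close> is a facet of a polytope \<open>\<Omega>\<close> with nonempty interior.\<close>

definition outward_unit_normal :: "(real^'d) set \<Rightarrow> (real^'d) set \<Rightarrow> real^'d" where
  "outward_unit_normal \<Omega> F =
     (THE n. norm n = 1 \<and> (\<forall>x\<in>F. \<forall>y\<in>\<Omega>. n \<bullet> (y - x) \<le> 0))"

text \<open>The surface integral of \<open>g\<close> times the \<open>m\<close>-th component of the outward unit normal, which is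
  constant on each facet; the edges have area zero.\<close>

definition boundary_integral :: "(real^3) set \<Rightarrow> 3 \<Rightarrow> (real^3 \<Rightarrow> real) \<Rightarrow> real" where
  "boundary_integral \<Omega> m g =
     (\<Sum>F\<in>{F. F facet_of \<Omega>}. outward_unit_normal \<Omega> F $ m * planar_integral F g)"


section \<open>Nodal summation-by-parts operators\<close>

definition symmetric_positive_definite :: "real^'n^'n \<Rightarrow> bool" where
  "symmetric_positive_definite W \<longleftrightarrow> transpose W = W \<and> (\<forall>x. x \<noteq> 0 \<longrightarrow> x \<bullet> (W *v x) > 0)"

definition diagonal_matrix :: "real^'n^'n \<Rightarrow> bool" where
  "diagonal_matrix W \<longleftrightarrow> (\<forall>i j. i \<noteq> j \<longrightarrow> W $ i $ j = 0)"

text \<open>\<open>D\<close> approximates the \<open>m\<close>-th partial derivative on \<open>\<Omega>\<close> with nodes \<open>\<xi>\<close>, norm matrix \<open>W\<close> and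
  boundary operator \<open>E\<close>. The nodes are indexed by a finite type. The domain is a solid convex
  polytope in three-space (in particular compact and connected), the class of domains for which
  the surface integral has been defined above.\<close>

definition nodal_SBP_operator ::
  "(real^3) set \<Rightarrow> ('n::finite \<Rightarrow> real^3) \<Rightarrow> 3 \<Rightarrow> nat \<Rightarrow>
   real^'n^'n \<Rightarrow> real^'n^'n \<Rightarrow> real^'n^'n \<Rightarrow> bool" where
  "nodal_SBP_operator \<Omega> \<xi> m p D W E \<longleftrightarrow>
     polytope \<Omega> \<and> interior \<Omega> \<noteq> {} \<and> inj \<xi> \<and> range \<xi> \<subseteq> \<Omega>
     \<and> (\<forall>V \<in> poly_space p. D *v nodal_values \<xi> V = nodal_values \<xi> (partial_deriv m V))
     \<and> symmetric_positive_definite W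
     \<and> (\<exists>Q. D = matrix_inv W ** Q \<and> Q + transpose Q = E)
     \<and> (\<exists>r\<ge>p. \<forall>U \<in> poly_space r. \<forall>V \<in> poly_space r.
           nodal_values \<xi> U \<bullet> (E *v nodal_values \<xi> V)
             = boundary_integral \<Omega> m (\<lambda>x. U x * V x))"

definition diagonal_norm_nodal_SBP_operator ::
  "(real^3) set \<Rightarrow> ('n::finite \<Rightarrow> real^3) \<Rightarrow> 3 \<Rightarrow> nat \<Rightarrow>
   real^'n^'n \<Rightarrow> real^'n^'n \<Rightarrow> real^'n^'n \<Rightarrow> bool" where
  "diagonal_norm_nodal_SBP_operator \<Omega> \<xi> m p D W E \<longleftrightarrow>
     nodal_SBP_operator \<Omega> \<xi> m p D W E \<and> diagonal_matrix W"

text \<open>\<open>R\<close> takes values at the nodes \<open>\<xi>\<close> to values at the facet nodes \<open>\<xi>f\<close>.\<close>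

definition interp_extrap_operator ::
  "('n::finite \<Rightarrow> real^'d) \<Rightarrow> ('f::finite \<Rightarrow> real^'d) \<Rightarrow> nat \<Rightarrow> real^'n^'f \<Rightarrow> bool" where
  "interp_extrap_operator \<xi> \<xi>f r R \<longleftrightarrow>
     (\<forall>V \<in> poly_space r. R *v nodal_values \<xi> V = nodal_values \<xi>f V)"


section \<open>Reference tetrahedron\<close>

definition reference_tetrahedron :: "(real^3) set" where
  "reference_tetrahedron =
     {\<xi>. (\<forall>i. \<xi> $ i \<in> {-1..1}) \<and> \<xi> $ 1 + \<xi> $ 2 + \<xi> $ 3 \<le> -1}"

text \<open>Outward unit normals, in this order, of the facets on which
  \<open>\<xi>\<^sub>2 = -1\<close>, \<open>\<xi>\<^sub>1 + \<xi>\<^sub>2 + \<xi>\<^sub>3 = -1\<close>, \<open>\<xi>\<^sub>1 = -1\<close>, \<open>\<xi>\<^sub>3 = -1\<close>.\<close>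

definition facet_normal :: "nat \<Rightarrow> real^3" where
  "facet_normal \<zeta> =
     (if \<zeta> = 1 then vector [0, -1, 0]
      else if \<zeta> = 2 then vector [1 / sqrt 3, 1 / sqrt 3, 1 / sqrt 3]
      else if \<zeta> = 3 then vector [-1, 0, 0]
      else vector [0, 0, -1])"

definition collapsed_map :: "real \<Rightarrow> real \<Rightarrow> real \<Rightarrow> real^3" where
  "collapsed_map \<eta>\<^sub>1 \<eta>\<^sub>2 \<eta>\<^sub>3 =
     vector [1/4 * (1 + \<eta>\<^sub>1) * (1 - \<eta>\<^sub>2) * (1 - \<eta>\<^sub>3) - 1, 1/2 * (1 + \<eta>\<^sub>2) * (1 - \<eta>\<^sub>3) - 1, \<eta>\<^sub>3]"

end

theory Submission
  imports Defs
begin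

text \<open>
  In collapsed coordinates a polynomial of total degree at most \<open>q\<close> has degree at most \<open>q\<close> in each
  variable separately, so the tensor-product Lagrange basis reproduces it, and the operators
  \<open>D\<^sup>(\<^sup>m\<^sup>)\<close> are exact by the chain rule. Multiplying by the weights cancels all the denominators
  of \<open>D\<^sup>(\<^sup>m\<^sup>)\<close>, so that every entry of \<open>Q = W D\<close> is a sum of products of one-dimensional sums, each of
  which the rules integrate exactly. Hence \<open>Q + Q\<^sup>T\<close> is computed by integrating by parts in one
  variable at a time: the volume terms cancel and the remaining boundary terms are exactly what
  the facet rules evaluate in \<open>E\<close>. Finally, the surface measure of a facet is transported to
  the square \<open>[-1,1]\<^sup>2\<close> by the collapsed map of a triangle, whose Jacobian is the factor in the
  facet weights.\<close>

section \<open>Polynomial functions of one variable\<close>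

text \<open>Condition (ii) concerns all entries of the matrices, not just polynomials of degree
  \<open>q\<close>, so it is checked on products of Lagrange polynomials of the full degrees
  \<open>q1\<close>, \<open>q2\<close>, \<open>q3\<close>. The degrees of exactness fit this
  exactly. In direction 1 the worst integrand is \<open>1 + \<eta>1\<close> times a basis polynomial
  times a derivative, of degree \<open>2 * q1\<close>. In direction 2 it is
  \<open>(1 - \<eta>2) * (1 + \<eta>2)\<close> times such a product, or \<open>1 - \<eta>2\<close>
  times two basis polynomials, both of degree \<open>2 * q2 + 1\<close>. In direction 3 one factor
  \<open>1 - \<eta>3\<close> is kept as a weight, and degree \<open>2 * q3\<close> remains. The
  terms that must cancel come from differentiating the metric factors. Each is a product of exact
  one-dimensional mass matrices and is removed by the next variable. For this it matters that the
  volume rules, where these matrices are diagonal, and the facet rules, with other nodes, reproduce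
  the same matrices. A separate obstacle lies in the surface integral: it rests on an arbitrarily
  chosen isometry and on normals given by a unique description, so both have to be determined from
  their defining properties alone.\<close>

definition polyfun :: "nat \<Rightarrow> (real \<Rightarrow> real) \<Rightarrow> bool" where
  "polyfun n f \<longleftrightarrow> (\<exists>p. degree p \<le> n \<and> f = poly p)"

lemma polyfun_mono: "polyfun m f \<Longrightarrow> m \<le> n \<Longrightarrow> polyfun n f"
  unfolding polyfun_def using le_trans by blast

lemma polyfun_const: "polyfun 0 (\<lambda>x. c)"
  unfolding polyfun_def by (rule exI[of _ "[:c:]"]) auto

lemma polyfun_linear: "polyfun 1 (\<lambda>x. a * x + b)"
  unfolding polyfun_def by (rule exI[of _ "[:b, a:]"]) auto

lemma polyfun_add: "polyfun n f \<Longrightarrow> polyfun n g \<Longrightarrow> polyfun n (\<lambda>x. f x + g x)"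
  unfolding polyfun_def
proof safe
  fix p r :: "real poly" assume "degree p \<le> n" "degree r \<le> n"
  then show "\<exists>s. degree s \<le> n \<and> (\<lambda>x. poly p x + poly r x) = poly s"
    by (intro exI[of _ "p + r"]) (auto simp: degree_add_le)
qed

lemma polyfun_mult: "polyfun m f \<Longrightarrow> polyfun n g \<Longrightarrow> polyfun (m + n) (\<lambda>x. f x * g x)"
  unfolding polyfun_def
proof safe
  fix p r :: "real poly" assume "degree p \<le> m" "degree r \<le> n"
  then show "\<exists>s. degree s \<le> m + n \<and> (\<lambda>x. poly p x * poly r x) = poly s"
    using degree_mult_le[of p r] by (intro exI[of _ "p * r"]) auto
qed

lemma polyfun_power: "polyfun m f \<Longrightarrow> polyfun (k * m) (\<lambda>x. f x ^ k)"
  by (induction k) (auto simp: polyfun_mult polyfun_const[of 1, simplified])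

lemma polyfun_sum:
  "finite A \<Longrightarrow> (\<And>k. k \<in> A \<Longrightarrow> polyfun n (f k)) \<Longrightarrow> polyfun n (\<lambda>x. \<Sum>k\<in>A. f k x)"
  by (induction A rule: finite_induct)
     (auto intro: polyfun_add polyfun_mono[OF polyfun_const])

lemma polyfun_prod:
  "finite A \<Longrightarrow> (\<And>k. k \<in> A \<Longrightarrow> polyfun (n k) (f k)) \<Longrightarrow>
     polyfun (\<Sum>k\<in>A. n k) (\<lambda>x. \<Prod>k\<in>A. f k x)"
  by (induction A rule: finite_induct) (auto intro: polyfun_mult polyfun_const)

lemma polyfun_continuous: "polyfun n f \<Longrightarrow> continuous_on S f"
  unfolding polyfun_def by (auto intro: continuous_intros)

section \<open>Lagrange interpolation and one-dimensional summation by parts\<close>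

text \<open>The basis functions as formal polynomials, for which \<open>degree\<close> and
  \<open>pderiv\<close> are available.\<close>

definition lagrange_poly :: "nat \<Rightarrow> (nat \<Rightarrow> real) \<Rightarrow> nat \<Rightarrow> real poly" where
  "lagrange_poly q \<eta> i = (\<Prod>j\<in>{0..q} - {i}. smult (1 / (\<eta> i - \<eta> j)) [:- \<eta> j, 1:])"

lemma lagrange_basis_eq_poly: "lagrange_basis q \<eta> i = poly (lagrange_poly q \<eta> i)"
  by (simp add: fun_eq_iff lagrange_basis_def lagrange_poly_def poly_prod diff_divide_distrib)

lemma degree_lagrange_poly:
  assumes "i \<le> q"
  shows "degree (lagrange_poly q \<eta> i) \<le> q"
proof -
  have "degree (lagrange_poly q \<eta> i)
      \<le> (\<Sum>j\<in>{0..q} - {i}. degree (smult (1 / (\<eta> i - \<eta> j)) [:- \<eta> j, 1:]))"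
    unfolding lagrange_poly_def using degree_prod_sum_le[of "{0..q} - {i}"] by (metis (no_types, lifting) comp_apply finite_Diff finite_atLeastAtMost sum.cong)
  also have "\<dots> \<le> (\<Sum>j\<in>{0..q} - {i}. 1)"
    by (intro sum_mono order_trans[OF degree_smult_le]) simp
  also have "\<dots> = q" using assms by simp
  finally show ?thesis .
qed

lemma poly_lagrange_poly_node:
  assumes "inj_on \<eta> {0..q}" "i \<le> q" "j \<le> q"
  shows "poly (lagrange_poly q \<eta> i) (\<eta> j) = of_bool (i = j)"
proof (cases "i = j")
  case True
  have "(\<Prod>k\<in>{0..q} - {j}. (\<eta> j - \<eta> k) / (\<eta> j - \<eta> k)) = (\<Prod>k\<in>{0..q} - {j}. 1)"
    using assms by (intro prod.cong) (auto simp: inj_on_def)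
  with True show ?thesis by (simp flip: lagrange_basis_eq_poly add: lagrange_basis_def)
next
  case False
  then show ?thesis
    using assms by (auto simp flip: lagrange_basis_eq_poly simp: lagrange_basis_def)
qed

text \<open>Both sides have degree at most \<open>q\<close> and agree at \<open>q + 1\<close>
  distinct points.\<close>

lemma lagrange_interpolation_poly:
  assumes "inj_on \<eta> {0..q}" "degree p \<le> q"
  shows "p = (\<Sum>i=0..q. smult (poly p (\<eta> i)) (lagrange_poly q \<eta> i))"
proof (rule poly_eqI_degree[where A = "\<eta> ` {0..q}"])
  let ?P = "\<Sum>i=0..q. smult (poly p (\<eta> i)) (lagrange_poly q \<eta> i)"
  fix x assume "x \<in> \<eta> ` {0..q}"
  then obtain j where j: "j \<le> q" "x = \<eta> j" by auto
  have "poly ?P x = (\<Sum>i=0..q. poly p (\<eta> i) * of_bool (i = j))"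
    using j assms by (auto simp: poly_sum poly_lagrange_poly_node intro!: sum.cong)
  then show "poly p x = poly ?P x"
    using j by (simp add: sum.delta' of_bool_def if_distrib cong: if_cong)
next
  show "degree p < card (\<eta> ` {0..q})"
    using assms by (simp add: card_image)
  have "degree (\<Sum>i=0..q. smult (poly p (\<eta> i)) (lagrange_poly q \<eta> i)) \<le> q"
    by (intro degree_sum_le) (auto intro: order_trans[OF degree_smult_le] degree_lagrange_poly)
  then show "degree (\<Sum>i=0..q. smult (poly p (\<eta> i)) (lagrange_poly q \<eta> i)) < card (\<eta> ` {0..q})"
    using assms by (simp add: card_image)
qed

lemma lagrange_interpolation:
  assumes "inj_on \<eta> {0..q}" "polyfun q f"
  shows "(\<Sum>i=0..q. lagrange_basis q \<eta> i x * f (\<eta> i)) = f x"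
proof -
  obtain p where p: "degree p \<le> q" "f = poly p" using assms by (auto simp: polyfun_def)
  have "poly p x = poly (\<Sum>i=0..q. smult (poly p (\<eta> i)) (lagrange_poly q \<eta> i)) x"
    using lagrange_interpolation_poly[OF assms(1) p(1)] by metis
  then show ?thesis by (simp add: p poly_sum lagrange_basis_eq_poly mult.commute)
qed

lemma deriv_poly: "deriv (poly p) (x :: real) = poly (pderiv p) x"
  by (rule DERIV_imp_deriv) (rule poly_DERIV)

lemma lagrange_interpolation_deriv:
  assumes "inj_on \<eta> {0..q}" "polyfun q f"
  shows "(\<Sum>i=0..q. deriv (lagrange_basis q \<eta> i) x * f (\<eta> i)) = deriv f x"
proof -
  obtain p where p: "degree p \<le> q" "f = poly p" using assms by (auto simp: polyfun_def)
  have "pderiv p = pderiv (\<Sum>i=0..q. smult (poly p (\<eta> i)) (lagrange_poly q \<eta> i))"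
    using lagrange_interpolation_poly[OF assms(1) p(1)] by metis
  then have "poly (pderiv p) x = poly (pderiv (\<Sum>i=0..q. smult (poly p (\<eta> i)) (lagrange_poly q \<eta> i))) x"
    by metis
  then show ?thesis
    by (simp add: p poly_sum lagrange_basis_eq_poly deriv_poly higher_pderiv_sum[of 1, simplified]
        pderiv_smult mult.commute)
qed

lemma poly_mult_fun: "poly (p * r) = (\<lambda>x. poly p x * poly r x)"
  and smult_poly_fun: "poly (smult c p) = (\<lambda>x. c * poly p x)"
  and zero_poly_fun: "poly 0 = (\<lambda>x. 0)"
  and poly_add_fun: "poly (p + r) = (\<lambda>x. poly p x + poly r x)"
  by auto

text \<open>The Jacobi weight is a polynomial \<open>\<rho>\<close>, here 1 or 1 - x, so that the
  whole integrand is a polynomial and integration by parts can be carried out with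
  \<open>pderiv\<close>.\<close>

definition weighted_rule :: "nat \<Rightarrow> real poly \<Rightarrow> nat \<Rightarrow> (nat \<Rightarrow> real) \<Rightarrow> (nat \<Rightarrow> real) \<Rightarrow> bool" where
  "weighted_rule N \<rho> q \<eta> \<omega> \<longleftrightarrow>
     (\<forall>V. degree V \<le> N \<longrightarrow> (\<Sum>i=0..q. poly V (\<eta> i) * \<omega> i) = integral {-1..1} (poly (V * \<rho>)))"

lemma weighted_rule_1: "quadrature_exact 0 0 N q \<eta> \<omega> \<Longrightarrow> weighted_rule N 1 q \<eta> \<omega>"
  by (auto simp: quadrature_exact_def weighted_rule_def)

text \<open>A rule for the exponents \<open>(0,0)\<close> turns into one for \<open>(1,0)\<close> when the factor \<open>1 - \<eta>\<close> is
  moved into the weights, at the cost of one degree. This makes the two alternatives alike.\<close>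

lemma weighted_rule_absorb:
  fixes a :: nat
  assumes "(a = 0 \<and> quadrature_exact 0 0 (N + 1) q \<eta> \<omega>) \<or> (a = 1 \<and> quadrature_exact 1 0 N q \<eta> \<omega>)"
  shows "weighted_rule N [:1, -1:] q \<eta> (\<lambda>i. if a = 0 then (1 - \<eta> i) * \<omega> i else \<omega> i)"
  using assms
proof (elim disjE conjE)
  assume a: "a = 0" and ex: "quadrature_exact 0 0 (N + 1) q \<eta> \<omega>"
  show ?thesis unfolding weighted_rule_def
  proof safe
    fix V :: "real poly" assume "degree V \<le> N"
    then have "degree (V * [:1, -1:]) \<le> N + 1"
      using degree_mult_le[of V "[:1, -1:]"] by simp
    then show "(\<Sum>i=0..q. poly V (\<eta> i) * (if a = 0 then (1 - \<eta> i) * \<omega> i else \<omega> i)) =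
        integral {-1..1} (poly (V * [:1, -1:]))"
      using ex a unfolding quadrature_exact_def
      by (auto simp: poly_mult_fun algebra_simps simp del: mult_pCons_right
          dest!: spec[of _ "V * [:1, -1:]"])
  qed
next
  assume "a = 1" "quadrature_exact 1 0 N q \<eta> \<omega>"
  then show ?thesis
    unfolding quadrature_exact_def weighted_rule_def by (simp add: poly_mult_fun mult.commute del: mult_pCons_right)
qed

lemma weighted_rule_polyfun:
  assumes "weighted_rule N \<rho> q \<eta> \<omega>" "polyfun N f"
  shows "(\<Sum>i=0..q. f (\<eta> i) * \<omega> i) = integral {-1..1} (\<lambda>x. f x * poly \<rho> x)"
  using assms by (auto simp: weighted_rule_def polyfun_def poly_mult_fun)

text \<open>The exact mass matrix of the Lagrange basis for the weight \<open>g\<close>. No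
  quadrature rule enters, so sums over volume nodes and over facet nodes can both be expressed by
  it.\<close>

definition lagrange_gram :: "nat \<Rightarrow> (nat \<Rightarrow> real) \<Rightarrow> real poly \<Rightarrow> nat \<Rightarrow> nat \<Rightarrow> real" where
  "lagrange_gram q \<eta> g a b =
     integral {-1..1} (poly (g * lagrange_poly q \<eta> a * lagrange_poly q \<eta> b))"

text \<open>The nodes \<open>\<eta>'\<close> of the rule may differ from the nodes
  \<open>\<eta>\<close> of the basis, as they do on the facets. All that counts is that a product of
  two basis polynomials has degree at most \<open>2 * q\<close>.\<close>

lemma lagrange_gram_sum:
  assumes "weighted_rule N \<rho> q' \<eta>' \<omega>'" "2 * q \<le> N" "a \<le> q" "b \<le> q"
  shows "(\<Sum>i=0..q'. lagrange_basis q \<eta> a (\<eta>' i) * lagrange_basis q \<eta> b (\<eta>' i) * \<omega>' i)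
    = lagrange_gram q \<eta> \<rho> a b"
proof -
  have "degree (lagrange_poly q \<eta> a * lagrange_poly q \<eta> b) \<le> N"
    using degree_lagrange_poly[of a q \<eta>] degree_lagrange_poly[of b q \<eta>] assms
      degree_mult_le[of "lagrange_poly q \<eta> a" "lagrange_poly q \<eta> b"] by linarith
  then have "(\<Sum>i=0..q'. poly (lagrange_poly q \<eta> a * lagrange_poly q \<eta> b) (\<eta>' i) * \<omega>' i)
      = integral {-1..1} (poly (lagrange_poly q \<eta> a * lagrange_poly q \<eta> b * \<rho>))"
    using assms(1) unfolding weighted_rule_def by blast
  then show ?thesis by (simp add: lagrange_basis_eq_poly lagrange_gram_def algebra_simps)
qed

text \<open>Against a cardinal polynomial the rule sees only the node \<open>\<eta> a\<close>. A
  single weighted point value thus equals an integral, provided the additional degree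
  \<open>q\<close> is still integrated exactly.\<close>

lemma weighted_rule_at_node:
  assumes "weighted_rule N \<rho> q \<eta> \<omega>" "inj_on \<eta> {0..q}" "a \<le> q" "degree p + q \<le> N"
  shows "poly p (\<eta> a) * \<omega> a = integral {-1..1} (poly (p * lagrange_poly q \<eta> a * \<rho>))"
proof -
  have "degree (p * lagrange_poly q \<eta> a) \<le> N"
    using degree_lagrange_poly[of a q \<eta>] assms degree_mult_le[of p "lagrange_poly q \<eta> a"] by linarith
  then have "integral {-1..1} (poly (p * lagrange_poly q \<eta> a * \<rho>))
      = (\<Sum>i=0..q. poly (p * lagrange_poly q \<eta> a) (\<eta> i) * \<omega> i)"
    using assms(1) unfolding weighted_rule_def by metis
  also have "\<dots> = (\<Sum>i=0..q. poly p (\<eta> i) * of_bool (a = i) * \<omega> i)"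
    using assms by (intro sum.cong) (auto simp: poly_lagrange_poly_node)
  also have "\<dots> = poly p (\<eta> a) * \<omega> a"
    using assms by (simp add: of_bool_def if_distrib if_distribR sum.delta cong: if_cong)
  finally show ?thesis by simp
qed

text \<open>The collocated mass matrix coincides with the exact one. This replaces the Kronecker
  deltas in the entries of \<open>W ** D\<close> by exact mass matrices, which can then cancel
  against those left over by integration by parts.\<close>

lemma lagrange_gram_diag:
  assumes "weighted_rule N \<rho> q \<eta> \<omega>" "inj_on \<eta> {0..q}" "a \<le> q" "b \<le> q" "degree g + 2 * q \<le> N"
  shows "poly g (\<eta> a) * \<omega> a * of_bool (a = b) = lagrange_gram q \<eta> (g * \<rho>) a b"
proof -
  have "degree (g * lagrange_poly q \<eta> b) + q \<le> N"
    using degree_lagrange_poly[of b q \<eta>] assms degree_mult_le[of g "lagrange_poly q \<eta> b"] by linarith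
  from weighted_rule_at_node[OF assms(1-3) this] show ?thesis
    using assms by (simp add: lagrange_gram_def poly_lagrange_poly_node algebra_simps eq_commute)
qed

lemma integral_poly_pderiv:
  "integral {-1..1} (poly (pderiv p)) = poly p 1 - poly p (-1 :: real)"
  by (intro integral_unique fundamental_theorem_of_calculus)
     (auto simp flip: has_real_derivative_iff_has_vector_derivative intro!: poly_DERIV
       DERIV_subset[OF poly_DERIV])

lemma integrable_poly [simp]: "poly (p :: real poly) integrable_on {a..b}"
  by (intro integrable_continuous_interval continuous_intros)

lemma integral_poly_add:
  "integral {a..b} (poly (p + r)) = integral {a..b} (poly p) + integral {a..b} (poly (r :: real poly))"
  using integral_add[OF integrable_poly[of p a b] integrable_poly[of r a b]] by (simp add: poly_add_fun)

text \<open>The product rule for \<open>g * \<rho> * L a * L b\<close>, integrated. Quadrature is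
  applied only to products containing a differentiated basis polynomial, and differentiation lowers
  the degree by one, hence the bound \<open>N + 1\<close>. The term with the derivative of
  \<open>g * \<rho>\<close> remains an exact integral.\<close>

lemma lagrange_sbp:
  assumes rule: "weighted_rule N \<rho> q \<eta> \<omega>" and inj: "inj_on \<eta> {0..q}" and ab: "a \<le> q" "b \<le> q"
    and deg: "degree g + 2 * q \<le> N + 1"
  shows "poly g (\<eta> a) * \<omega> a * deriv (lagrange_basis q \<eta> b) (\<eta> a)
       + poly g (\<eta> b) * \<omega> b * deriv (lagrange_basis q \<eta> a) (\<eta> b)
       = poly (g * \<rho>) 1 * lagrange_basis q \<eta> a 1 * lagrange_basis q \<eta> b 1
         - poly (g * \<rho>) (-1) * lagrange_basis q \<eta> a (-1) * lagrange_basis q \<eta> b (-1)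
         - lagrange_gram q \<eta> (pderiv (g * \<rho>)) a b"
proof -
  define L where "L = lagrange_poly q \<eta>"
  have half: "poly g (\<eta> a) * \<omega> a * deriv (lagrange_basis q \<eta> b) (\<eta> a)
      = integral {-1..1} (poly (g * pderiv (L b) * L a * \<rho>))"
    if ab: "a \<le> q" "b \<le> q" for a b
  proof (cases "pderiv (L b) = 0")
    \<comment> \<open>A constant basis polynomial is treated apart: differentiating it gains no
      degree in the truncated difference \<open>degree (L b) - 1\<close>, so for
      \<open>q = 0\<close> the degree bound could fail. Here both sides vanish.\<close>
    case True
    then show ?thesis
      by (simp add: lagrange_basis_eq_poly deriv_poly zero_poly_fun flip: L_def)
  next
    case False
    then have "degree (L b) \<noteq> 0" by (simp add: pderiv_eq_0_iff)
    moreover have "degree (L b) \<le> q" using degree_lagrange_poly ab by (simp add: L_def)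
    ultimately have "degree (g * pderiv (L b)) + q \<le> N"
      using degree_mult_le[of g "pderiv (L b)"] deg by (simp add: degree_pderiv)
    from weighted_rule_at_node[OF rule inj ab(1) this] show ?thesis
      by (simp add: lagrange_basis_eq_poly deriv_poly L_def algebra_simps)
  qed
  have "pderiv (g * \<rho> * L a * L b) = (pderiv (g * \<rho>) * L a * L b)
      + (g * pderiv (L b) * L a * \<rho> + g * pderiv (L a) * L b * \<rho>)"
    by (simp add: pderiv_mult algebra_simps)
  then have "integral {-1..1} (poly (pderiv (g * \<rho> * L a * L b)))
     = lagrange_gram q \<eta> (pderiv (g * \<rho>)) a b
      + (integral {-1..1} (poly (g * pderiv (L b) * L a * \<rho>))
       + integral {-1..1} (poly (g * pderiv (L a) * L b * \<rho>)))"
    by (simp only: integral_poly_add lagrange_gram_def L_def)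
  then show ?thesis
    using half[OF ab] half[OF ab(2) ab(1)]
    by (simp add: integral_poly_pderiv lagrange_basis_eq_poly L_def)
qed

lemma lagrange_gram_add:
  "lagrange_gram q \<eta> (g + h) a b = lagrange_gram q \<eta> g a b + lagrange_gram q \<eta> h a b"
  by (simp add: lagrange_gram_def ring_distribs integral_poly_add del: poly_add)

lemma lagrange_gram_smult:
  "lagrange_gram q \<eta> (smult c g) a b = c * lagrange_gram q \<eta> g a b"
  by (simp add: lagrange_gram_def smult_poly_fun poly_mult_fun)

section \<open>Polynomials of bounded total degree\<close>

lemma finite_multi_indices: "finite {k :: 'd::finite \<Rightarrow> nat. (\<Sum>i\<in>UNIV. k i) \<le> p}"
proof (rule finite_subset)
  show "{k :: 'd \<Rightarrow> nat. (\<Sum>i\<in>UNIV. k i) \<le> p} \<subseteq> PiE UNIV (\<lambda>_. {..p})"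
    by (auto simp: PiE_def extensional_def) (meson finite UNIV_I member_le_sum order_trans zero_le)
  show "finite (PiE (UNIV :: 'd set) (\<lambda>_. {..p}))"
    by (intro finite_PiE) auto
qed

text \<open>Along a curve with affine components each factor of a monomial has degree at most 1 in
  the parameter, so the total degree bounds the degree in the parameter.\<close>

lemma poly_space_compose_polyfun:
  assumes "V \<in> poly_space p" "\<And>i. polyfun 1 (\<lambda>t. \<gamma> t $ i)"
  shows "polyfun p (\<lambda>t. V (\<gamma> t))"
proof -
  obtain c where V: "\<And>x. V x = (\<Sum>k\<in>{k. (\<Sum>i\<in>UNIV. k i) \<le> p}. c k * (\<Prod>i\<in>UNIV. (x $ i) ^ k i))"
    using assms(1) unfolding poly_space_def by blast
  have "polyfun p (\<lambda>t. c k * (\<Prod>i\<in>UNIV. (\<gamma> t $ i) ^ k i))" if "(\<Sum>i\<in>UNIV. k i) \<le> p" for k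
  proof -
    have "polyfun (k i) (\<lambda>t. (\<gamma> t $ i) ^ k i)" for i
      using polyfun_power[OF assms(2)[of i], of "k i"] by simp
    then have "polyfun (0 + (\<Sum>i\<in>UNIV. k i)) (\<lambda>t. c k * (\<Prod>i\<in>UNIV. (\<gamma> t $ i) ^ k i))"
      by (intro polyfun_mult polyfun_prod polyfun_const) auto
    then show ?thesis using that polyfun_mono by auto
  qed
  then show ?thesis
    unfolding V by (intro polyfun_sum finite_multi_indices) auto
qed

lemma poly_space_has_derivative:
  fixes V :: "real^'d \<Rightarrow> real"
  assumes "V \<in> poly_space p"
  obtains V' where "(V has_derivative V') (at x)"
proof -
  obtain c where V: "\<And>x. V x = (\<Sum>k\<in>{k. (\<Sum>i\<in>UNIV. k i) \<le> p}. c k * (\<Prod>i\<in>UNIV. (x $ i) ^ k i))"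
    using assms unfolding poly_space_def by blast
  have "finite A \<Longrightarrow> (\<lambda>x. \<Prod>i\<in>A. (x $ i) ^ k i) differentiable (at x)"
    for A and k :: "'d \<Rightarrow> nat"
  proof (induction A rule: finite_induct)
    case (insert i F)
    have "(\<lambda>x :: real^'d. x $ i) differentiable (at x)"
      by (intro bounded_linear_imp_differentiable bounded_linear_vec_nth)
    then show ?case using insert
      by (auto intro!: differentiable_mult differentiable_power)
  qed simp
  then have "V differentiable (at x)"
    unfolding V[abs_def]
    by (intro differentiable_sum finite_multi_indices ballI differentiable_mult
          differentiable_const) simp
  then show ?thesis using that by (auto simp: differentiable_def)
qed

lemma partial_deriv_has_derivative:
  assumes "(V has_derivative V') (at x)"
  shows "partial_deriv m V x = V' (axis m 1)"
proof -
  have "((\<lambda>t. x + t *\<^sub>R axis m 1) has_derivative (\<lambda>h. h *\<^sub>R axis m 1)) (at 0)"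
    by (auto intro!: derivative_eq_intros)
  moreover have "(V has_derivative V') (at (x + 0 *\<^sub>R axis m (1::real)))"
    using assms by simp
  ultimately have "((\<lambda>t. V (x + t *\<^sub>R axis m 1)) has_derivative (\<lambda>h. V' (h *\<^sub>R axis m 1))) (at 0)"
    by (rule has_derivative_compose)
  then have "((\<lambda>t. V (x + t *\<^sub>R axis m 1)) has_real_derivative V' (axis m 1)) (at 0)"
    by (rule has_derivative_imp_has_field_derivative)
       (simp add: linear_scale[OF has_derivative_linear[OF assms]])
  then show ?thesis
    unfolding partial_deriv_def by (rule DERIV_imp_deriv)
qed

lemma deriv_along_curve:
  fixes V :: "real^'d \<Rightarrow> real"
  assumes "V \<in> poly_space p" "(\<gamma> has_vector_derivative v) (at t)"
  shows "deriv (\<lambda>t. V (\<gamma> t)) t = (\<Sum>m\<in>UNIV. v $ m * partial_deriv m V (\<gamma> t))"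
proof -
  obtain V' where V': "(V has_derivative V') (at (\<gamma> t))"
    using poly_space_has_derivative[OF assms(1)] by blast
  then have lin: "linear V'" by (rule has_derivative_linear)
  have "((\<lambda>t. V (\<gamma> t)) has_derivative (\<lambda>h. V' (h *\<^sub>R v))) (at t)"
    using assms(2) V' unfolding has_vector_derivative_def by (rule has_derivative_compose)
  then have "((\<lambda>t. V (\<gamma> t)) has_real_derivative V' v) (at t)"
    by (rule has_derivative_imp_has_field_derivative) (simp add: linear_scale[OF lin])
  then have "deriv (\<lambda>t. V (\<gamma> t)) t = V' v" by (rule DERIV_imp_deriv)
  also have "v = (\<Sum>m\<in>UNIV. v $ m *\<^sub>R axis m 1)"
    using basis_expansion[of v] by (simp add: scalar_mult_eq_scaleR)
  also have "V' \<dots> = (\<Sum>m\<in>UNIV. v $ m * V' (axis m 1))"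
    by (simp add: linear_sum[OF lin] linear_scale[OF lin])
  finally show ?thesis by (simp add: partial_deriv_has_derivative[OF V'])
qed

lemma poly_space_continuous:
  fixes V :: "real^'d \<Rightarrow> real"
  assumes "V \<in> poly_space p" shows "continuous_on S V"
  by (rule continuous_at_imp_continuous_on)
     (metis poly_space_has_derivative[OF assms] has_derivative_continuous)

section \<open>The collapsed coordinate map\<close>

lemma collapsed_map_nth:
  "collapsed_map x y z $ 1 = 1/4 * (1 + x) * (1 - y) * (1 - z) - 1"
  "collapsed_map x y z $ 2 = 1/2 * (1 + y) * (1 - z) - 1"
  "collapsed_map x y z $ 3 = z"
  by (simp_all add: collapsed_map_def)

lemma polyfun_linearI:
  assumes "\<And>x. f x = a * x + b" shows "polyfun 1 f"
proof -
  have "f = (\<lambda>x. a * x + b)" using assms by blast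
  then show ?thesis using polyfun_linear by simp
qed

text \<open>The collapsed map is not affine, but it is affine in each variable while the other two
  are fixed; hence no degree is gained in any single variable.\<close>

lemma polyfun_collapsed_map:
  assumes "V \<in> poly_space p"
  shows "polyfun p (\<lambda>x. V (collapsed_map x y z))"
    and "polyfun p (\<lambda>y. V (collapsed_map x y z))"
    and "polyfun p (\<lambda>z. V (collapsed_map x y z))"
proof -
  have "polyfun 1 (\<lambda>x. collapsed_map x y z $ i)" for i
    using exhaust_3[of i]
  proof (elim disjE)
    assume "i = 1" then show ?thesis
      by (intro polyfun_linearI[where a = "(1 - y) * (1 - z) / 4" and b = "(1 - y) * (1 - z) / 4 - 1"])
         (simp add: collapsed_map_nth field_simps)
  qed (simp_all add: collapsed_map_nth polyfun_mono[OF polyfun_const])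
  then show "polyfun p (\<lambda>x. V (collapsed_map x y z))"
    by (rule poly_space_compose_polyfun[OF assms])
  have "polyfun 1 (\<lambda>y. collapsed_map x y z $ i)" for i
    using exhaust_3[of i]
  proof (elim disjE)
    assume "i = 1" then show ?thesis
      by (intro polyfun_linearI[where a = "- (1 + x) * (1 - z) / 4" and b = "(1 + x) * (1 - z) / 4 - 1"])
         (simp add: collapsed_map_nth field_simps)
  next
    assume "i = 2" then show ?thesis
      by (intro polyfun_linearI[where a = "(1 - z) / 2" and b = "(1 - z) / 2 - 1"])
         (simp add: collapsed_map_nth field_simps)
  qed (simp_all add: collapsed_map_nth polyfun_mono[OF polyfun_const])
  then show "polyfun p (\<lambda>y. V (collapsed_map x y z))"
    by (rule poly_space_compose_polyfun[OF assms])
  have "polyfun 1 (\<lambda>z. collapsed_map x y z $ i)" for i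
    using exhaust_3[of i]
  proof (elim disjE)
    assume "i = 1" then show ?thesis
      by (intro polyfun_linearI[where a = "- (1 + x) * (1 - y) / 4" and b = "(1 + x) * (1 - y) / 4 - 1"])
         (simp add: collapsed_map_nth field_simps)
  next
    assume "i = 2" then show ?thesis
      by (intro polyfun_linearI[where a = "- (1 + y) / 2" and b = "(1 + y) / 2 - 1"])
         (simp add: collapsed_map_nth field_simps)
  next
    assume "i = 3" then show ?thesis
      by (intro polyfun_linearI[where a = 1 and b = 0]) (simp add: collapsed_map_nth)
  qed
  then show "polyfun p (\<lambda>z. V (collapsed_map x y z))"
    by (rule poly_space_compose_polyfun[OF assms])
qed

lemma has_vector_derivative_vec3:
  assumes "\<And>i. ((\<lambda>t. (f t :: real^3) $ i) has_real_derivative v $ i) (at t)"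
  shows "(f has_vector_derivative v) (at t)"
  unfolding has_vector_derivative_def has_derivative_componentwise_within[of f]
proof
  fix b :: "real^3" assume "b \<in> Basis"
  then obtain i where b: "b = axis i 1" by (auto simp: Basis_vec_def)
  show "((\<lambda>x. f x \<bullet> b) has_derivative (\<lambda>x. x *\<^sub>R v \<bullet> b)) (at t)"
    using assms[of i] by (simp add: b inner_axis has_field_derivative_def mult.commute[of _ "v $ i"])
qed

text \<open>The coefficients are the columns of the Jacobian matrix of the collapsed map. The system
  is triangular in the three partial derivatives, so it can be solved for them successively.\<close>

lemma collapsed_map_chain_rule:
  assumes V: "V \<in> poly_space p"
  shows "deriv (\<lambda>x. V (collapsed_map x y z)) x
      = (1 - y) * (1 - z) / 4 * partial_deriv 1 V (collapsed_map x y z)"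
    and "deriv (\<lambda>y. V (collapsed_map x y z)) y
      = - (1 + x) * (1 - z) / 4 * partial_deriv 1 V (collapsed_map x y z)
        + (1 - z) / 2 * partial_deriv 2 V (collapsed_map x y z)"
    and "deriv (\<lambda>z. V (collapsed_map x y z)) z
      = - (1 + x) * (1 - y) / 4 * partial_deriv 1 V (collapsed_map x y z)
        - (1 + y) / 2 * partial_deriv 2 V (collapsed_map x y z)
        + partial_deriv 3 V (collapsed_map x y z)"
proof -
  have "((\<lambda>x. collapsed_map x y z) has_vector_derivative vector [(1 - y) * (1 - z) / 4, 0, 0]) (at x)"
  proof (rule has_vector_derivative_vec3)
    fix i :: 3
    show "((\<lambda>x. collapsed_map x y z $ i) has_real_derivative
        vector [(1 - y) * (1 - z) / 4, 0, 0] $ i) (at x)"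
      using exhaust_3[of i]
      by (elim disjE) (auto simp: collapsed_map_nth intro!: derivative_eq_intros)
  qed
  from deriv_along_curve[OF V this]
  show "deriv (\<lambda>x. V (collapsed_map x y z)) x
      = (1 - y) * (1 - z) / 4 * partial_deriv 1 V (collapsed_map x y z)"
    by (simp add: sum_3)
  have "((\<lambda>y. collapsed_map x y z) has_vector_derivative
      vector [- (1 + x) * (1 - z) / 4, (1 - z) / 2, 0]) (at y)"
  proof (rule has_vector_derivative_vec3)
    fix i :: 3
    show "((\<lambda>y. collapsed_map x y z $ i) has_real_derivative
        vector [- (1 + x) * (1 - z) / 4, (1 - z) / 2, 0] $ i) (at y)"
      using exhaust_3[of i]
      by (elim disjE) (auto simp: collapsed_map_nth field_simps intro!: derivative_eq_intros)
  qed
  from deriv_along_curve[OF V this]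
  show "deriv (\<lambda>y. V (collapsed_map x y z)) y
      = - (1 + x) * (1 - z) / 4 * partial_deriv 1 V (collapsed_map x y z)
        + (1 - z) / 2 * partial_deriv 2 V (collapsed_map x y z)"
    by (simp add: sum_3)
  have "((\<lambda>z. collapsed_map x y z) has_vector_derivative
      vector [- (1 + x) * (1 - y) / 4, - (1 + y) / 2, 1]) (at z)"
  proof (rule has_vector_derivative_vec3)
    fix i :: 3
    show "((\<lambda>z. collapsed_map x y z $ i) has_real_derivative
        vector [- (1 + x) * (1 - y) / 4, - (1 + y) / 2, 1] $ i) (at z)"
      using exhaust_3[of i]
      by (elim disjE) (auto simp: collapsed_map_nth field_simps intro!: derivative_eq_intros)
  qed
  from deriv_along_curve[OF V this]
  show "deriv (\<lambda>z. V (collapsed_map x y z)) z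
      = - (1 + x) * (1 - y) / 4 * partial_deriv 1 V (collapsed_map x y z)
        - (1 + y) / 2 * partial_deriv 2 V (collapsed_map x y z)
        + partial_deriv 3 V (collapsed_map x y z)"
    by (simp add: sum_3 field_simps)
qed

text \<open>The coordinates are recovered from the last to the first, with divisions by
  \<open>1 - z\<close> and \<open>1 - y\<close>. The map degenerates where \<open>y = 1\<close> or
  \<open>z = 1\<close>, which is why the second and third sets of volume nodes exclude 1.\<close>

lemma collapsed_map_inj:
  assumes "collapsed_map x y z = collapsed_map x' y' z'" "y < 1" "z < 1"
  shows "x = x' \<and> y = y' \<and> z = z'"
proof -
  have z: "z' = z" using arg_cong[OF assms(1), of "\<lambda>v. v $ 3"] by (simp add: collapsed_map_nth)
  have y: "y' = y" using arg_cong[OF assms(1), of "\<lambda>v. v $ 2"] assms(3)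
    by (simp add: collapsed_map_nth z)
  have "x' = x" using arg_cong[OF assms(1), of "\<lambda>v. v $ 1"] assms(2,3)
    by (simp add: collapsed_map_nth z y)
  with y z show ?thesis by simp
qed

lemma collapsed_map_in_tetrahedron:
  assumes "x \<in> {-1..1}" "y \<in> {-1..1}" "z \<in> {-1..1}"
  shows "collapsed_map x y z \<in> reference_tetrahedron"
proof -
  \<comment> \<open>In these variables the coordinates are \<open>s * ((1 - y) * t) - 1\<close>,
    \<open>(1 + y) * t - 1\<close> and \<open>1 - 2 * t\<close>. Their sum is at most -1, with
    equality when \<open>s = 1\<close>.\<close>
  define s t where "s = (1 + x) / 2" and "t = (1 - z) / 2"
  have st: "0 \<le> s" "s \<le> 1" "0 \<le> t" "t \<le> 1" using assms by (auto simp: s_def t_def)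
  have A: "0 \<le> (1 - y) * t" "s * ((1 - y) * t) \<le> (1 - y) * t" "0 \<le> s * ((1 - y) * t)"
    "0 \<le> (1 + y) * t"
    using st assms by (auto intro!: mult_left_le_one_le)
  have eq: "1/4 * (1 + x) * (1 - y) * (1 - z) - 1 = s * ((1 - y) * t) - 1"
    "1/2 * (1 + y) * (1 - z) - 1 = (1 + y) * t - 1" "z = 1 - 2 * t"
    by (simp_all add: s_def t_def field_simps)
  show ?thesis
    unfolding reference_tetrahedron_def mem_Collect_eq forall_3 collapsed_map_nth
    using A st assms unfolding eq(1,2) by (auto simp: eq(3) algebra_simps)
qed

section \<open>Surface integrals over triangles\<close>

text \<open>Polarization turns preserved distances into preserved inner products, and then the
  defect of linearity has norm zero. Nothing but preservation of distances is known of the isometry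
  chosen in \<open>planar_integral\<close>.\<close>

lemma isometry_plane_orthonormal:
  fixes \<phi> :: "real^2 \<Rightarrow> real^3"
  assumes iso: "\<And>u v. dist (\<phi> u) (\<phi> v) = dist u v"
  obtains a b where "a \<bullet> a = 1" "b \<bullet> b = 1" "a \<bullet> b = 0"
    "\<And>u. \<phi> u = \<phi> 0 + u $ 1 *\<^sub>R a + u $ 2 *\<^sub>R b"
proof -
  define L where "L u = \<phi> u - \<phi> 0" for u
  have n: "norm (L u) = norm u" for u
    using iso[of u 0] by (simp add: L_def dist_norm)
  have d: "norm (L u - L v) = norm (u - v)" for u v
    using iso[of u v] by (simp add: L_def dist_norm)
  have inn: "L u \<bullet> L v = u \<bullet> v" for u v
    using d[of u v] n[of u] n[of v] by (simp add: dot_norm_neg)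
  have lin: "L u = u $ 1 *\<^sub>R L (axis 1 1) + u $ 2 *\<^sub>R L (axis 2 1)" for u
  proof -
    let ?e = "L u - (u $ 1 *\<^sub>R L (axis 1 1) + u $ 2 *\<^sub>R L (axis 2 1))"
    have "?e \<bullet> ?e = 0"
      by (simp add: inner_diff_left inner_diff_right inner_add_left inner_add_right inn)
         (simp add: inner_vec_def sum_2 axis_def algebra_simps)
    then show ?thesis by simp
  qed
  show ?thesis
  proof
    show "\<phi> u = \<phi> 0 + u $ 1 *\<^sub>R L (axis 1 1) + u $ 2 *\<^sub>R L (axis 2 1)" for u
      using lin[of u] by (simp add: L_def algebra_simps)
  qed (simp_all add: inn inner_axis axis_eq_axis, simp add: axis_def)
qed

text \<open>The coordinate map between \<open>real^2\<close> and pairs takes boxes to boxes and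
  preserves their content, so the integral can be transported to pairs, where Fubini's theorem
  applies.\<close>

lemma integral_real2:
  fixes f :: "real^2 \<Rightarrow> real"
  assumes "continuous_on (cbox (vector [a, c]) (vector [b, d])) f"
  shows "integral (cbox (vector [a, c]) (vector [b, d])) f
    = integral {c..d} (\<lambda>y. integral {a..b} (\<lambda>x. f (vector [x, y])))"
proof -
  let ?g = "\<lambda>p :: real \<times> real. vector [fst p, snd p] :: real^2"
  let ?h = "\<lambda>v :: real^2. (v $ 1, v $ 2)"
  have gh: "vector [v $ 1, v $ 2] = v" for v :: "real^2" by (simp add: vec_eq_iff forall_2)
  have hg: "?h (?g p) = p" for p by simp
  have cb: "cbox u v = {x. u $ 1 \<le> x $ 1 \<and> x $ 1 \<le> v $ 1 \<and> u $ 2 \<le> x $ 2 \<and> x $ 2 \<le> v $ 2}"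
    for u v :: "real^2" by (auto simp: cbox_def mem_box_cart forall_2 Basis_vec_def inner_axis)
  have cbp: "cbox p r = {x. fst p \<le> fst x \<and> fst x \<le> fst r \<and> snd p \<le> snd x \<and> snd x \<le> snd r}"
    for p r :: "real \<times> real" by (auto simp: cbox_Pair_eq[of "fst p" "snd p" "fst r" "snd r", simplified])
  have himg: "?h ` cbox u v = cbox (?h u) (?h v)" for u v
  proof -
    have "\<exists>w. w \<in> cbox u v \<and> p = ?h w" if "p \<in> cbox (?h u) (?h v)" for p
      using that hg[of p] by (intro exI[of _ "?g p"]) (auto simp: cb cbp)
    then show ?thesis by (auto simp: cb cbp image_iff)
  qed
  have gimg: "?g ` cbox p r = cbox (?g p) (?g r)" for p r
  proof -
    have "\<exists>w. w \<in> cbox p r \<and> v = ?g w" if "v \<in> cbox (?g p) (?g r)" for v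
      using that gh[of v] by (intro exI[of _ "?h v"]) (auto simp: cb cbp)
    then show ?thesis by (auto simp: cb cbp image_iff)
  qed
  have cont: "measure lborel (?h ` cbox u v) = 1 * measure lborel (cbox u v)" for u v
  proof -
    have "measure lborel (cbox u v) = (if cbox u v = {} then 0 else (v $ 1 - u $ 1) * (v $ 2 - u $ 2))"
      by (simp add: content_cbox_if_cart prod_2 UNIV_2)
    moreover have "measure lborel (cbox (?h u) (?h v)) =
        measure lborel (cbox (u $ 1) (v $ 1)) * measure lborel (cbox (u $ 2) (v $ 2))"
      by (rule content_Pair)
    moreover have "cbox u v = {} \<longleftrightarrow> v $ 1 < u $ 1 \<or> v $ 2 < u $ 2"
      using forall_2[of "\<lambda>i. \<not> v $ i < u $ i"] unfolding interval_eq_empty_cart by blast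
    ultimately show ?thesis unfolding himg by (simp del: content_cbox_cart)
  qed
  have contg: "continuous_on S ?g" for S
  proof -
    have "?g p = fst p *\<^sub>R axis 1 1 + snd p *\<^sub>R axis 2 1" for p
      by (simp add: vec_eq_iff forall_2 axis_def)
    then show ?thesis by (auto intro!: continuous_intros)
  qed
  have contfg: "continuous_on (cbox (a, c) (b, d)) (\<lambda>p. f (?g p))"
    using gimg[of "(a, c)" "(b, d)"] assms
    by (intro continuous_on_compose2[OF _ contg]) auto
  have "((\<lambda>p. f (?g p)) has_integral integral (cbox (a, c) (b, d)) (\<lambda>p. f (?g p))) (cbox (a, c) (b, d))"
    by (intro integrable_integral integrable_continuous contfg)
  then have "((\<lambda>v. f (?g (?h v))) has_integral (1 / 1) *\<^sub>R integral (cbox (a, c) (b, d)) (\<lambda>p. f (?g p)))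
      (?g ` cbox (a, c) (b, d))"
    using himg gimg cont
    by (intro has_integral_twiddle[where r = 1]) (auto simp: gh hg intro!: continuous_intros)
  then have "integral (cbox (vector [a, c]) (vector [b, d])) f
      = integral (cbox (a, c) (b, d)) (\<lambda>(x, y). f (vector [x, y]))"
    by (simp add: gh gimg integral_unique case_prod_unfold)
  also have "\<dots> = integral {a..b} (\<lambda>x. integral {c..d} (\<lambda>y. f (vector [x, y])))"
    using integral_prod_continuous[of a c b d "\<lambda>p. f (?g p)"] contfg by (simp add: case_prod_unfold)
  \<comment> \<open>The Jacobian of a collapsed triangle depends on the second coordinate only, so
    the integral over that coordinate is wanted outside.\<close>
  also have "\<dots> = integral {c..d} (\<lambda>y. integral {a..b} (\<lambda>x. f (vector [x, y])))"
    using integral_swap_continuous[of a c b d "\<lambda>x y. f (vector [x, y])"] contfg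
    by (simp add: case_prod_unfold)
  finally show ?thesis .
qed

text \<open>The square \<open>[-1,1]\<^sup>2\<close> is mapped onto the triangle with vertices \<open>A\<close>, \<open>A + v\<close>, \<open>A + w\<close>; its edge
  \<open>y = 1\<close> is collapsed to \<open>A + w\<close> and is left out wherever injectivity matters.\<close>

definition duffy :: "real^3 \<Rightarrow> real^3 \<Rightarrow> real^3 \<Rightarrow> real \<Rightarrow> real \<Rightarrow> real^3" where
  "duffy A v w x y = A + ((1 + x) * (1 - y) / 4) *\<^sub>R v + ((1 + y) / 2) *\<^sub>R w"

definition planar_triangle :: "real^3 \<Rightarrow> real^3 \<Rightarrow> real^3 \<Rightarrow> (real^3) set" where
  "planar_triangle A v w = {A + s *\<^sub>R v + t *\<^sub>R w | s t. 0 \<le> s \<and> 0 \<le> t \<and> s + t \<le> 1}"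

lemma planar_triangle_eq_hull: "planar_triangle A v w = convex hull {A, A + v, A + w}"
  unfolding planar_triangle_def convex_hull_3_alt by (auto simp: algebra_simps)

text \<open>The general theorem is about vector-valued functions, so the real-valued
  \<open>f\<close> is passed through \<open>real^1\<close>.\<close>

lemma change_of_variables_real2:
  fixes f :: "real^2 \<Rightarrow> real" and g :: "real^2 \<Rightarrow> real^2"
  assumes "S \<in> sets lebesgue" "\<And>x. x \<in> S \<Longrightarrow> (g has_derivative g' x) (at x within S)" "inj_on g S"
    "(\<lambda>x. \<bar>det (matrix (g' x))\<bar> * f (g x)) absolutely_integrable_on S"
  shows "integral (g ` S) f = integral S (\<lambda>x. \<bar>det (matrix (g' x))\<bar> * f (g x))"
proof -
  let ?F = "\<lambda>x. vec (f x) :: real^1"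
  have "(\<lambda>x. \<bar>det (matrix (g' x))\<bar> *\<^sub>R ?F (g x)) absolutely_integrable_on S"
    using assms(4) by (simp add: absolutely_integrable_on_1_iff)
  then have "integral (g ` S) ?F = integral S (\<lambda>x. \<bar>det (matrix (g' x))\<bar> *\<^sub>R ?F (g x))"
    by (intro integral_change_of_variables[OF assms(1-3)]) auto
  then show ?thesis by (simp add: integral_on_1_eq)
qed

text \<open>Gram-Schmidt orthonormalization of \<open>v\<close> and \<open>w\<close>, which are
  independent because their Gram determinant is positive. Existence is what gives the choice
  operator in \<open>planar_integral\<close> its defining property.\<close>

lemma isometry_onto_plane_exists:
  fixes A v w :: "real^3"
  assumes "(v \<bullet> v) * (w \<bullet> w) - (v \<bullet> w)\<^sup>2 > 0"
  shows "\<exists>\<phi> :: real^2 \<Rightarrow> real^3.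
    (\<forall>u u'. dist (\<phi> u) (\<phi> u') = dist u u') \<and> planar_triangle A v w \<subseteq> range \<phi>"
proof -
  define a where "a = (1 / norm v) *\<^sub>R v"
  define z where "z = w - (w \<bullet> a) *\<^sub>R a"
  define b where "b = (1 / norm z) *\<^sub>R z"
  have v0: "v \<noteq> 0" using assms by auto
  then have aa: "a \<bullet> a = 1" by (simp add: a_def dot_square_norm power2_eq_square)
  have za: "z \<bullet> a = 0" by (simp add: z_def inner_diff_left aa)
  have z0: "z \<noteq> 0"
  proof
    assume "z = 0"
    then have "w = (w \<bullet> a / norm v) *\<^sub>R v" by (simp add: z_def a_def)
    then obtain k where "w = k *\<^sub>R v" by blast
    then show False using assms by (simp add: power2_eq_square)
  qed
  then have bb: "b \<bullet> b = 1" by (simp add: b_def dot_square_norm power2_eq_square)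
  have ab: "a \<bullet> b = 0" "b \<bullet> a = 0" using za by (simp_all add: b_def inner_commute)
  have v: "v = norm v *\<^sub>R a" using v0 by (simp add: a_def)
  have w: "w = (w \<bullet> a) *\<^sub>R a + norm z *\<^sub>R b" using z0 by (simp add: b_def z_def)
  define \<phi> :: "real^2 \<Rightarrow> real^3" where "\<phi> u = A + u $ 1 *\<^sub>R a + u $ 2 *\<^sub>R b" for u
  have "dist (\<phi> u) (\<phi> u') = dist u u'" for u u'
  proof -
    have "\<phi> u - \<phi> u' = (u - u') $ 1 *\<^sub>R a + (u - u') $ 2 *\<^sub>R b"
      by (simp add: \<phi>_def algebra_simps)
    then have "(\<phi> u - \<phi> u') \<bullet> (\<phi> u - \<phi> u') = (u - u') \<bullet> (u - u')"
      by (simp add: inner_add_left inner_add_right aa bb ab inner_vec_def[where 'b=2] sum_2)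
    then show ?thesis by (simp add: dist_norm norm_eq_sqrt_inner)
  qed
  moreover have "planar_triangle A v w \<subseteq> range \<phi>"
  proof
    fix x assume "x \<in> planar_triangle A v w"
    then obtain s t where "x = A + s *\<^sub>R v + t *\<^sub>R w" by (auto simp: planar_triangle_def)
    also have "\<dots> = A + s *\<^sub>R (norm v *\<^sub>R a) + t *\<^sub>R ((w \<bullet> a) *\<^sub>R a + norm z *\<^sub>R b)"
      using v w by metis
    also have "\<dots> = \<phi> (vector [s * norm v + t * (w \<bullet> a), t * norm z])"
      by (simp add: \<phi>_def algebra_simps)
    finally show "x \<in> range \<phi>" by blast
  qed
  ultimately show ?thesis by blast
qed

text \<open>Since \<open>p\<close> and \<open>r\<close> are independent, a point determines
  \<open>s\<close> and \<open>t\<close>, and these determine the collapsed coordinates as long as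
  \<open>x $ 2 < 1\<close>. The omitted edge would be mapped to the single point
  \<open>c + r\<close>, which is therefore missing from the image.\<close>

lemma image_duffy_real2:
  fixes c p r :: "real^2"
  defines "g \<equiv> \<lambda>x :: real^2. c + ((1 + x $ 1) * (1 - x $ 2) / 4) *\<^sub>R p + ((1 + x $ 2) / 2) *\<^sub>R r"
  defines "S \<equiv> {x :: real^2. -1 \<le> x $ 1 \<and> x $ 1 \<le> 1 \<and> -1 \<le> x $ 2 \<and> x $ 2 < 1}"
  assumes d: "p $ 1 * r $ 2 - p $ 2 * r $ 1 \<noteq> 0"
  shows "inj_on g S"
    and "g ` S = {c + s *\<^sub>R p + t *\<^sub>R r | s t. 0 \<le> s \<and> 0 \<le> t \<and> s + t \<le> 1} - {c + r}"
proof -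
  have coords: "s = s' \<and> t = t'"
    if "c + s *\<^sub>R p + t *\<^sub>R r = c + s' *\<^sub>R p + t' *\<^sub>R r" for s t s' t'
  proof -
    have e: "(s - s') * p $ i + (t - t') * r $ i = 0" for i
      using arg_cong[OF that, of "\<lambda>v. v $ i"] by (simp add: algebra_simps)
    have "(s - s') * (p $ 1 * r $ 2 - p $ 2 * r $ 1) = 0"
      using e[of 1] e[of 2] by algebra
    moreover have "(t - t') * (p $ 1 * r $ 2 - p $ 2 * r $ 1) = 0"
      using e[of 1] e[of 2] by algebra
    ultimately show ?thesis using d by simp
  qed
  show "inj_on g S"
  proof (rule inj_onI)
    fix x y assume xy: "x \<in> S" "y \<in> S" "g x = g y"
    then have "(1 + x $ 1) * (1 - x $ 2) / 4 = (1 + y $ 1) * (1 - y $ 2) / 4 \<and>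
        (1 + x $ 2) / 2 = (1 + y $ 2) / 2"
      unfolding g_def by (intro coords)
    then have "x $ 2 = y $ 2" "(1 + x $ 1) * (1 - x $ 2) = (1 + y $ 1) * (1 - y $ 2)"
      by auto
    with xy show "x = y" by (auto simp: S_def vec_eq_iff forall_2)
  qed
  show "g ` S = {c + s *\<^sub>R p + t *\<^sub>R r | s t. 0 \<le> s \<and> 0 \<le> t \<and> s + t \<le> 1} - {c + r}"
  proof (intro set_eqI iffI)
    fix u assume "u \<in> g ` S"
    then obtain x where x: "x \<in> S" "u = g x" by blast
    let ?s = "(1 + x $ 1) * (1 - x $ 2) / 4" and ?t = "(1 + x $ 2) / 2"
    have "(1 + x $ 1) * (1 - x $ 2) \<le> 2 * (1 - x $ 2)"
      using x by (intro mult_right_mono) (auto simp: S_def)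
    then have "?s + ?t \<le> 1" by (simp add: field_simps)
    moreover have "0 \<le> ?s" "0 \<le> ?t" using x by (auto simp: S_def)
    moreover have "u \<noteq> c + r"
      using coords[of ?s ?t 0 1] x by (auto simp: g_def S_def)
    moreover have "u = c + ?s *\<^sub>R p + ?t *\<^sub>R r" using x by (simp add: g_def)
    ultimately show "u \<in> {c + s *\<^sub>R p + t *\<^sub>R r | s t. 0 \<le> s \<and> 0 \<le> t \<and> s + t \<le> 1} - {c + r}"
      by blast
  next
    fix u assume "u \<in> {c + s *\<^sub>R p + t *\<^sub>R r | s t. 0 \<le> s \<and> 0 \<le> t \<and> s + t \<le> 1} - {c + r}"
    then obtain s t where st: "u = c + s *\<^sub>R p + t *\<^sub>R r" "0 \<le> s" "0 \<le> t" "s + t \<le> 1" "u \<noteq> c + r"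
      by blast
    have "t \<noteq> 1" using st by auto
    then have t1: "t < 1" using st by simp
    \<comment> \<open>Obtained by solving \<open>t = (1 + x $ 2) / 2\<close> for
      \<open>x $ 2\<close>, so that \<open>1 - x $ 2 = 2 * (1 - t)\<close>, and then
      \<open>s = (1 + x $ 1) * (1 - x $ 2) / 4\<close> for \<open>x $ 1\<close>.\<close>
    let ?x = "vector [2 * s / (1 - t) - 1, 2 * t - 1] :: real^2"
    have "2 * s / (1 - t) \<le> 2" "0 \<le> 2 * s / (1 - t)" using st t1 by (auto simp: field_simps)
    then have "?x \<in> S" using st t1 by (simp add: S_def)
    moreover have "(1 + ?x $ 1) * (1 - ?x $ 2) / 4 = s" "(1 + ?x $ 2) / 2 = t"
      using t1 by (auto simp: field_simps)
    then have "g ?x = u" by (simp add: g_def st)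
    ultimately show "u \<in> g ` S" by blast
  qed
qed

lemma duffy_has_derivative:
  fixes c p r :: "real^2"
  shows "((\<lambda>x. c + ((1 + x $ 1) * (1 - x $ 2) / 4) *\<^sub>R p + ((1 + x $ 2) / 2) *\<^sub>R r) has_derivative
    (\<lambda>h. ((h $ 1 * (1 - x $ 2) - (1 + x $ 1) * h $ 2) / 4) *\<^sub>R p + (h $ 2 / 2) *\<^sub>R r)) (at x within S)"
  by (auto intro!: derivative_eq_intros bounded_linear_imp_has_derivative bounded_linear_vec_nth
      simp: algebra_simps add_divide_distrib diff_divide_distrib)

text \<open>The columns are \<open>(1 - x2) / 4\<close> times \<open>p\<close>, and half of
  \<open>r\<close> plus a multiple of \<open>p\<close>. That multiple does not change the
  determinant; the 8 is 4 times 2.\<close>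

lemma det_duffy_derivative:
  fixes p r :: "real^2"
  shows "det (matrix (\<lambda>h. ((h $ 1 * (1 - x2) - (1 + x1) * h $ 2) / 4) *\<^sub>R p + (h $ 2 / 2) *\<^sub>R r))
    = (1 - x2) / 8 * (p $ 1 * r $ 2 - p $ 2 * r $ 1)"
  by (simp add: det_2 matrix_def axis_def) (simp add: field_simps)

text \<open>Whatever isometry was chosen, the triangle pulls back to a plane triangle with edge
  vectors \<open>p\<close> and \<open>r\<close>. Their determinant is, up to sign, the square root
  of the Gram determinant of \<open>v\<close> and \<open>w\<close>, so the choice drops out.\<close>

lemma planar_integral_triangle:
  fixes A v w :: "real^3"
  assumes gram: "(v \<bullet> v) * (w \<bullet> w) - (v \<bullet> w)\<^sup>2 > 0"
    and cont: "continuous_on UNIV f"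
  shows "planar_integral (planar_triangle A v w) f = sqrt ((v \<bullet> v) * (w \<bullet> w) - (v \<bullet> w)\<^sup>2) / 8 *
    integral {-1..1} (\<lambda>y. integral {-1..1} (\<lambda>x. f (duffy A v w x y)) * (1 - y))"
proof -
  define \<phi> where "\<phi> = (SOME \<phi> :: real^2 \<Rightarrow> real^3.
    (\<forall>u u'. dist (\<phi> u) (\<phi> u') = dist u u') \<and> planar_triangle A v w \<subseteq> range \<phi>)"
  have \<phi>: "\<And>u u'. dist (\<phi> u) (\<phi> u') = dist u u'" "planar_triangle A v w \<subseteq> range \<phi>"
    using someI_ex[OF isometry_onto_plane_exists[OF gram]] unfolding \<phi>_def by auto
  obtain a b where ab: "a \<bullet> a = 1" "b \<bullet> b = 1" "a \<bullet> b = 0"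
    and lin: "\<And>u. \<phi> u = \<phi> 0 + u $ 1 *\<^sub>R a + u $ 2 *\<^sub>R b"
    using isometry_plane_orthonormal[OF \<phi>(1)] by metis
  have vert: "A \<in> planar_triangle A v w" "A + v \<in> planar_triangle A v w" "A + w \<in> planar_triangle A v w"
    by (simp_all add: planar_triangle_eq_hull hull_inc)
  obtain c c1 c2 where c: "A = \<phi> c" "A + v = \<phi> c1" "A + w = \<phi> c2"
    using \<phi>(2) vert by blast
  define p r where "p = c1 - c" and "r = c2 - c"
  have v: "v = p $ 1 *\<^sub>R a + p $ 2 *\<^sub>R b"
    using c(1,2) lin[of c] lin[of c1] by (simp add: p_def algebra_simps)
  have w: "w = r $ 1 *\<^sub>R a + r $ 2 *\<^sub>R b"
    using c(1,3) lin[of c] lin[of c2] by (simp add: r_def algebra_simps)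
  define d where "d = p $ 1 * r $ 2 - p $ 2 * r $ 1"
  \<comment> \<open>In orthonormal coordinates the Gram determinant of two plane vectors is the
    square of their determinant (Lagrange's identity).\<close>
  have "d\<^sup>2 = (v \<bullet> v) * (w \<bullet> w) - (v \<bullet> w)\<^sup>2"
    unfolding v w d_def using ab
    by (simp add: inner_add_left inner_add_right inner_commute[of b a] power2_eq_square algebra_simps)
  then have d: "\<bar>d\<bar> = sqrt ((v \<bullet> v) * (w \<bullet> w) - (v \<bullet> w)\<^sup>2)" by (metis real_sqrt_abs)
  have d0: "d \<noteq> 0" using d gram by auto
  have \<phi>_pt: "\<phi> (c + s *\<^sub>R p + t *\<^sub>R r) = A + s *\<^sub>R v + t *\<^sub>R w" for s t
    using lin[of "c + s *\<^sub>R p + t *\<^sub>R r"] lin[of c] c(1) by (simp add: v w algebra_simps)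
  define g where "g = (\<lambda>x :: real^2.
      c + ((1 + x $ 1) * (1 - x $ 2) / 4) *\<^sub>R p + ((1 + x $ 2) / 2) *\<^sub>R r)"
  define S where "S = {x :: real^2. -1 \<le> x $ 1 \<and> x $ 1 \<le> 1 \<and> -1 \<le> x $ 2 \<and> x $ 2 < 1}"
  define T where "T = {c + s *\<^sub>R p + t *\<^sub>R r | s t. 0 \<le> s \<and> 0 \<le> t \<and> s + t \<le> 1}"
  define g' where "g' = (\<lambda>(x :: real^2) (h :: real^2).
      ((h $ 1 * (1 - x $ 2) - (1 + x $ 1) * h $ 2) / 4) *\<^sub>R p + (h $ 2 / 2) *\<^sub>R r)"
  define H where "H = (\<lambda>x. \<bar>det (matrix (g' x))\<bar> * f (\<phi> (g x)))"
  note img = image_duffy_real2[OF d0[unfolded d_def], of c, folded g_def S_def T_def]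
  let ?C = "cbox (vector [-1, -1]) (vector [1, 1]) :: (real^2) set"
  have det: "det (matrix (g' x)) = (1 - x $ 2) / 8 * d" for x :: "real^2"
    by (simp add: g'_def det_duffy_derivative d_def)
  have \<phi>_g: "\<phi> (g x) = duffy A v w (x $ 1) (x $ 2)" for x :: "real^2"
    by (simp add: g_def \<phi>_pt duffy_def)
  have "{u. \<phi> u \<in> planar_triangle A v w} = T"
  proof -
    have "inj \<phi>" using \<phi>(1) by (metis dist_eq_0_iff injI)
    then show ?thesis
      unfolding T_def planar_triangle_def \<phi>_pt[symmetric] by (auto dest: injD)
  qed
  then have "planar_integral (planar_triangle A v w) f = integral T (\<lambda>u. f (\<phi> u))"
    by (simp add: planar_integral_def Let_def \<phi>_def)
  also have "\<dots> = integral (g ` S) (\<lambda>u. f (\<phi> u))"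
    unfolding img(2) by (rule integral_spike_set) (auto intro: negligible_subset[of "{c + r}"])
  also have "\<dots> = integral S H"
    unfolding H_def
  proof (rule change_of_variables_real2)
    have "S = ?C \<inter> {x. x $ 2 < 1}"
      by (auto simp: S_def mem_box_cart forall_2)
    also have "\<dots> \<in> sets lebesgue"
      by (intro sets.Int) (auto simp: open_halfspace_component_lt_cart intro!: lmeasurable_cbox fmeasurableD)
    finally show S: "S \<in> sets lebesgue" .
    show "(g has_derivative g' x) (at x within S)" for x
      unfolding g_def g'_def by (rule duffy_has_derivative)
    show "inj_on g S" by (rule img(1))
    have "continuous_on ?C (\<lambda>x. f (duffy A v w (x $ 1) (x $ 2)))"
      unfolding duffy_def by (intro continuous_on_compose2[OF cont] continuous_intros) auto
    then have "continuous_on ?C (\<lambda>x. \<bar>det (matrix (g' x))\<bar> * f (\<phi> (g x)))"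
      unfolding det \<phi>_g by (intro continuous_intros) auto
    then have "(\<lambda>x. \<bar>det (matrix (g' x))\<bar> * f (\<phi> (g x))) absolutely_integrable_on ?C"
      by (rule absolutely_integrable_continuous)
    then show "(\<lambda>x. \<bar>det (matrix (g' x))\<bar> * f (\<phi> (g x))) absolutely_integrable_on S"
      by (rule set_integrable_subset) (use S in \<open>auto simp: S_def mem_box_cart forall_2\<close>)
  qed
  also have "\<dots> = integral ?C H"
  \<comment> \<open>The half-open and the closed square differ by a piece of the line
    \<open>x $ 2 = 1\<close>.\<close>
  proof (rule integral_spike_set)
    show "negligible {x \<in> S - ?C. H x \<noteq> 0}"
      by (rule negligible_subset[of "{}"]) (auto simp: S_def mem_box_cart forall_2)
    show "negligible {x \<in> ?C - S. H x \<noteq> 0}"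
      by (rule negligible_subset[OF negligible_standard_hyperplane[of "axis 2 1" 1]])
         (auto simp: S_def mem_box_cart forall_2 inner_axis)
  qed
  also have "\<dots> = integral {-1..1} (\<lambda>y. integral {-1..1} (\<lambda>x. H (vector [x, y])))"
  proof (rule integral_real2)
    show "continuous_on ?C H"
      unfolding H_def det \<phi>_g duffy_def
      by (intro continuous_intros continuous_on_compose2[OF cont]) auto
  qed
  also have "\<dots> = integral {-1..1}
      (\<lambda>y. \<bar>d\<bar> / 8 * (integral {-1..1} (\<lambda>x. f (duffy A v w x y)) * (1 - y)))"
  proof (rule integral_cong)
    fix y :: real assume "y \<in> {-1..1}"
    then have "(\<lambda>x. H (vector [x, y])) = (\<lambda>x. (\<bar>d\<bar> / 8 * (1 - y)) * f (duffy A v w x y))"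
      by (simp add: H_def det \<phi>_g abs_mult fun_eq_iff)
    then show "integral {-1..1} (\<lambda>x. H (vector [x, y]))
        = \<bar>d\<bar> / 8 * (integral {-1..1} (\<lambda>x. f (duffy A v w x y)) * (1 - y))"
      by simp
  qed
  finally show ?thesis by (simp add: d)
qed

section \<open>The facets of the reference tetrahedron\<close>

definition tetrahedron_vertices :: "(real^3) set" where
  "tetrahedron_vertices =
     {vector [-1, -1, -1], vector [1, -1, -1], vector [-1, 1, -1], vector [-1, -1, 1]}"

lemma vec3_eq_iff: "(x :: real^3) = y \<longleftrightarrow> x $ 1 = y $ 1 \<and> x $ 2 = y $ 2 \<and> x $ 3 = y $ 3"
  by (simp add: vec_eq_iff forall_3)

lemma vector3_eq_iff:
  "(vector [a, b, c] :: real^3) = vector [a', b', c'] \<longleftrightarrow> a = a' \<and> b = b' \<and> c = c'"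
  by (simp add: vec3_eq_iff)

lemma vector3_add:
  "(vector [a, b, c] :: real^3) + vector [a', b', c'] = vector [a + a', b + b', c + c']"
  and vector3_diff:
  "(vector [a, b, c] :: real^3) - vector [a', b', c'] = vector [a - a', b - b', c - c']"
  by (simp_all add: vec3_eq_iff)

lemma inner_vec3: "(x :: real^3) \<bullet> y = x $ 1 * y $ 1 + x $ 2 * y $ 2 + x $ 3 * y $ 3"
  by (simp add: inner_vec_def sum_3)

lemma reference_tetrahedron_iff:
  "x \<in> reference_tetrahedron \<longleftrightarrow> -1 \<le> x $ 1 \<and> -1 \<le> x $ 2 \<and> -1 \<le> x $ 3 \<and> x $ 1 + x $ 2 + x $ 3 \<le> -1"
  by (auto simp: reference_tetrahedron_def forall_3)

text \<open>This form makes the facets accessible through the description of the faces of a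
  simplex.\<close>

lemma reference_tetrahedron_eq_hull: "reference_tetrahedron = convex hull tetrahedron_vertices"
proof
  show "convex hull tetrahedron_vertices \<subseteq> reference_tetrahedron"
  proof (rule hull_minimal)
    show "tetrahedron_vertices \<subseteq> reference_tetrahedron"
      by (auto simp: tetrahedron_vertices_def reference_tetrahedron_iff)
    show "convex reference_tetrahedron"
    proof (rule convexI)
      fix x y :: "real^3" and u v :: real
      assume xy: "x \<in> reference_tetrahedron" "y \<in> reference_tetrahedron" and uv: "0 \<le> u" "0 \<le> v" "u + v = 1"
      \<comment> \<open>The bound -1 is written as \<open>u * -1 + v * -1\<close>, so that the
        inequalities can be added termwise.\<close>
      have ge: "u * -1 + v * -1 \<le> u * x $ i + v * y $ i" for i
        using xy uv exhaust_3[of i] by (intro add_mono mult_left_mono) (auto simp: reference_tetrahedron_iff)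
      have sum: "u * (x $ 1 + x $ 2 + x $ 3) + v * (y $ 1 + y $ 2 + y $ 3) \<le> u * -1 + v * -1"
        using xy uv by (intro add_mono mult_left_mono) (auto simp: reference_tetrahedron_iff)
      have "u * -1 + v * -1 = -1" using uv by simp
      then have "-1 \<le> u * x $ i + v * y $ i" for i using ge[of i] by metis
      moreover have "(u * x $ 1 + v * y $ 1) + (u * x $ 2 + v * y $ 2) + (u * x $ 3 + v * y $ 3) \<le> -1"
        using sum uv by (simp add: algebra_simps)
      ultimately show "u *\<^sub>R x + v *\<^sub>R y \<in> reference_tetrahedron"
        by (simp add: reference_tetrahedron_iff)
    qed
  qed
  show "reference_tetrahedron \<subseteq> convex hull tetrahedron_vertices"
  proof
    fix x :: "real^3" assume x: "x \<in> reference_tetrahedron"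
    let ?P = "\<lambda>i :: nat. if i = 0 then vector [-1, -1, -1] else if i = 1 then vector [1, -1, -1]
      else if i = 2 then vector [-1, 1, -1] else vector [-1, -1, 1] :: real^3"
    \<comment> \<open>Barycentric coordinates for the vertices \<open>?P\<close>. The one at the
      corner \<open>vector [-1, -1, -1]\<close> is the remainder that makes the sum 1; it is
      nonnegative by the oblique inequality.\<close>
    let ?u = "\<lambda>i :: nat. if i = 0 then (- 1 - x $ 1 - x $ 2 - x $ 3) / 2 else if i = 1 then (1 + x $ 1) / 2
      else if i = 2 then (1 + x $ 2) / 2 else (1 + x $ 3) / 2"
    have "(\<Sum>i\<in>{0, 1, 2, 3}. ?u i *\<^sub>R ?P i) \<in> convex hull tetrahedron_vertices"
      using x
      by (intro convex_sum convex_convex_hull)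
         (auto simp: reference_tetrahedron_iff tetrahedron_vertices_def field_simps intro!: hull_inc)
    also have "(\<Sum>i\<in>{0, 1, 2, 3}. ?u i *\<^sub>R ?P i) = x"
      by (simp add: vec3_eq_iff) (simp add: field_simps)
    finally show "x \<in> convex hull tetrahedron_vertices" .
  qed
qed

text \<open>The three edges at the corner \<open>vector [-1, -1, -1]\<close> are nonzero and
  pairwise orthogonal.\<close>

lemma affine_independent_tetrahedron: "\<not> affine_dependent tetrahedron_vertices"
proof -
  let ?S = "{vector [1, -1, -1], vector [-1, 1, -1], vector [-1, -1, 1]} :: (real^3) set"
  let ?a = "vector [-1, -1, -1] :: real^3"
  have "(\<lambda>x. x - ?a) ` ?S = {vector [2, 0, 0], vector [0, 2, 0], vector [0, 0, 2]}"
    by (simp add: vector3_diff)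
  moreover have "independent \<dots>"
    by (rule pairwise_orthogonal_independent)
       (auto simp: pairwise_def orthogonal_def inner_vec3 vec3_eq_iff)
  moreover have "?a \<notin> ?S" by (simp add: vector3_eq_iff)
  ultimately show ?thesis
    unfolding tetrahedron_vertices_def affine_dependent_iff_dependent[OF \<open>?a \<notin> ?S\<close>]
      Setcompr_eq_image by simp
qed

text \<open>Facets arise by omitting one vertex, and affine independence keeps those of different
  vertices apart. Two vertices are required because a facet is nonempty by definition.\<close>

lemma sum_facets_simplex:
  fixes S :: "'a::euclidean_space set"
  assumes "\<not> affine_dependent S" "card S \<ge> 2"
  shows "(\<Sum>F\<in>{F. F facet_of (convex hull S)}. h F) = (\<Sum>u\<in>S. h (convex hull (S - {u})))"
proof -
  have "convex hull (S - {u}) \<noteq> {}" if "u \<in> S" for u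
  proof
    assume "convex hull (S - {u}) = {}"
    then have "S \<subseteq> {u}" by auto
    then have "card S \<le> card {u}" by (intro card_mono) auto
    with assms(2) show False by simp
  qed
  then have "{F. F facet_of (convex hull S)} = (\<lambda>u. convex hull (S - {u})) ` S"
    unfolding facet_of_convex_hull_affine_independent[OF assms(1)] by blast
  moreover have "inj_on (\<lambda>u. convex hull (S - {u})) S"
  proof (rule inj_onI, rule ccontr)
    fix u u' assume u: "u \<in> S" "u' \<in> S" "convex hull (S - {u}) = convex hull (S - {u'})" "u \<noteq> u'"
    then have "u \<in> convex hull (S - {u'})" by (intro hull_inc) auto
    then have "u \<in> affine hull (S - {u})" using u(3) convex_hull_subset_affine_hull by blast
    with assms(1) u(1) show False unfolding affine_dependent_def by blast
  qed
  ultimately show ?thesis by (simp add: sum.reindex)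
qed

lemma outward_unit_normalI:
  assumes "norm n = 1" "\<And>x y. x \<in> F \<Longrightarrow> y \<in> \<Omega> \<Longrightarrow> n \<bullet> (y - x) \<le> 0"
    and "\<And>n'. norm n' = 1 \<Longrightarrow> (\<And>x y. x \<in> F \<Longrightarrow> y \<in> \<Omega> \<Longrightarrow> n' \<bullet> (y - x) \<le> 0) \<Longrightarrow> n' = n"
  shows "outward_unit_normal \<Omega> F = n"
  unfolding outward_unit_normal_def by (rule the_equality) (use assms in blast)+

text \<open>Comparing two vertices both ways round gives the inequality with both signs, hence
  orthogonality to the edges. This is the source of the uniqueness of the outward normal.\<close>

lemma outward_normal_triangle:
  assumes sub: "planar_triangle A v w \<subseteq> \<Omega>"
    and le: "\<And>x y. x \<in> planar_triangle A v w \<Longrightarrow> y \<in> \<Omega> \<Longrightarrow> n' \<bullet> (y - x) \<le> 0"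
  shows "n' \<bullet> v = 0" "n' \<bullet> w = 0"
proof -
  have vert: "A \<in> planar_triangle A v w" "A + v \<in> planar_triangle A v w" "A + w \<in> planar_triangle A v w"
    by (simp_all add: planar_triangle_eq_hull hull_inc)
  then show "n' \<bullet> v = 0" "n' \<bullet> w = 0"
    using le[of A "A + v"] le[of "A + v" A] le[of A "A + w"] le[of "A + w" A] sub
    by (auto simp: subset_iff)
qed

lemma norm_vec3_eq_1: "norm (x :: real^3) = 1 \<longleftrightarrow> x $ 1 * x $ 1 + x $ 2 * x $ 2 + x $ 3 * x $ 3 = 1"
  by (simp add: norm_eq_1 inner_vec3)

lemma sq_eq_1_neg: "x * x = 1 \<Longrightarrow> x \<le> 0 \<Longrightarrow> x = -1" for x :: real
  by (metis square_eq_1_iff neg_0_le_iff_le not_one_le_zero)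

text \<open>Base point and edges are ordered so that \<open>duffy\<close> agrees on each facet with
  the collapsed map with one coordinate fixed at -1 or 1; this is why \<open>facet2\<close> starts
  at another vertex.\<close>

abbreviation (input) "facet1 \<equiv> planar_triangle (vector [-1, -1, -1]) (vector [2, 0, 0]) (vector [0, 0, 2])"
abbreviation (input) "facet2 \<equiv> planar_triangle (vector [1, -1, -1]) (vector [-2, 2, 0]) (vector [-2, 0, 2])"
abbreviation (input) "facet3 \<equiv> planar_triangle (vector [-1, -1, -1]) (vector [0, 2, 0]) (vector [0, 0, 2])"
abbreviation (input) "facet4 \<equiv> planar_triangle (vector [-1, -1, -1]) (vector [2, 0, 0]) (vector [0, 2, 0])"

lemma facets_eq_hull:
  "convex hull (tetrahedron_vertices - {vector [-1, 1, -1]}) = facet1"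
  "convex hull (tetrahedron_vertices - {vector [-1, -1, -1]}) = facet2"
  "convex hull (tetrahedron_vertices - {vector [1, -1, -1]}) = facet3"
  "convex hull (tetrahedron_vertices - {vector [-1, -1, 1]}) = facet4"
  by (simp_all add: planar_triangle_eq_hull tetrahedron_vertices_def insert_Diff_if vector3_eq_iff
        vector3_add insert_commute)

lemma facets_subset:
  "facet1 \<subseteq> reference_tetrahedron" "facet2 \<subseteq> reference_tetrahedron"
  "facet3 \<subseteq> reference_tetrahedron" "facet4 \<subseteq> reference_tetrahedron"
  unfolding reference_tetrahedron_eq_hull facets_eq_hull[symmetric] by (intro hull_mono; blast)+

lemma facet_normal_nth:
  "facet_normal (Suc 0) = vector [0, -1, 0]"
  "facet_normal 1 = vector [0, -1, 0]"
  "facet_normal 2 = vector [1 / sqrt 3, 1 / sqrt 3, 1 / sqrt 3]"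
  "facet_normal 3 = vector [-1, 0, 0]"
  "facet_normal 4 = vector [0, 0, -1]"
  by (simp_all add: facet_normal_def)

lemma facet_coordinates:
  "x \<in> facet1 \<Longrightarrow> x $ 2 = -1" "x \<in> facet2 \<Longrightarrow> x $ 1 + x $ 2 + x $ 3 = -1"
  "x \<in> facet3 \<Longrightarrow> x $ 1 = -1" "x \<in> facet4 \<Longrightarrow> x $ 3 = -1"
  by (force simp: planar_triangle_def)+

text \<open>Orthogonality to two edges leaves a line of candidates, unit length leaves two vectors,
  and the vertex opposite to the facet decides the sign.\<close>

lemma outward_unit_normal_facets:
  "outward_unit_normal reference_tetrahedron facet1 = facet_normal 1" (is ?n1)
  "outward_unit_normal reference_tetrahedron facet2 = facet_normal 2" (is ?n2)
  "outward_unit_normal reference_tetrahedron facet3 = facet_normal 3" (is ?n3)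
  "outward_unit_normal reference_tetrahedron facet4 = facet_normal 4" (is ?n4)
proof -
  have vert: "vector [-1, -1, -1] \<in> reference_tetrahedron" "vector [1, -1, -1] \<in> reference_tetrahedron"
    "vector [-1, 1, -1] \<in> reference_tetrahedron" "vector [-1, -1, 1] \<in> reference_tetrahedron"
    by (simp_all add: reference_tetrahedron_iff)
  have A: "A \<in> planar_triangle A v w" for A v w by (simp add: planar_triangle_eq_hull hull_inc)
  show ?n1
  proof (rule outward_unit_normalI)
    fix n :: "real^3" assume n: "norm n = 1"
      and le: "\<And>x y. x \<in> facet1 \<Longrightarrow> y \<in> reference_tetrahedron \<Longrightarrow> n \<bullet> (y - x) \<le> 0"
    have "n $ 1 = 0" "n $ 3 = 0"
      using outward_normal_triangle[OF facets_subset(1) le] by (simp_all add: inner_vec3)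
    moreover have "n $ 2 \<le> 0" using le[OF A vert(3)] by (simp add: inner_vec3)
    ultimately show "n = facet_normal 1"
      using n sq_eq_1_neg[of "n $ 2"] by (simp add: vec3_eq_iff facet_normal_nth norm_vec3_eq_1)
  qed (simp_all add: facet_normal_nth norm_vec3_eq_1 inner_vec3 facet_coordinates reference_tetrahedron_iff)
  show ?n3
  proof (rule outward_unit_normalI)
    fix n :: "real^3" assume n: "norm n = 1"
      and le: "\<And>x y. x \<in> facet3 \<Longrightarrow> y \<in> reference_tetrahedron \<Longrightarrow> n \<bullet> (y - x) \<le> 0"
    have "n $ 2 = 0" "n $ 3 = 0"
      using outward_normal_triangle[OF facets_subset(3) le] by (simp_all add: inner_vec3)
    moreover have "n $ 1 \<le> 0" using le[OF A vert(2)] by (simp add: inner_vec3)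
    ultimately show "n = facet_normal 3"
      using n sq_eq_1_neg[of "n $ 1"] by (simp add: vec3_eq_iff facet_normal_nth norm_vec3_eq_1)
  qed (simp_all add: facet_normal_nth norm_vec3_eq_1 inner_vec3 facet_coordinates reference_tetrahedron_iff)
  show ?n4
  proof (rule outward_unit_normalI)
    fix n :: "real^3" assume n: "norm n = 1"
      and le: "\<And>x y. x \<in> facet4 \<Longrightarrow> y \<in> reference_tetrahedron \<Longrightarrow> n \<bullet> (y - x) \<le> 0"
    have "n $ 1 = 0" "n $ 2 = 0"
      using outward_normal_triangle[OF facets_subset(4) le] by (simp_all add: inner_vec3)
    moreover have "n $ 3 \<le> 0" using le[OF A vert(4)] by (simp add: inner_vec3)
    ultimately show "n = facet_normal 4"
      using n sq_eq_1_neg[of "n $ 3"] by (simp add: vec3_eq_iff facet_normal_nth norm_vec3_eq_1)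
  qed (simp_all add: facet_normal_nth norm_vec3_eq_1 inner_vec3 facet_coordinates reference_tetrahedron_iff)
  show ?n2
  proof (rule outward_unit_normalI)
    fix n :: "real^3" assume n: "norm n = 1"
      and le: "\<And>x y. x \<in> facet2 \<Longrightarrow> y \<in> reference_tetrahedron \<Longrightarrow> n \<bullet> (y - x) \<le> 0"
    have eq: "n $ 2 = n $ 1" "n $ 3 = n $ 1"
      using outward_normal_triangle[OF facets_subset(2) le] by (simp_all add: inner_vec3)
    have "n $ 1 \<ge> 0" using le[OF A vert(1)] by (simp add: inner_vec3)
    moreover have "(n $ 1)\<^sup>2 = 1 / 3" using n eq by (simp add: norm_vec3_eq_1 power2_eq_square)
    ultimately have "n $ 1 = sqrt (1 / 3)" by (metis real_sqrt_unique)
    then show "n = facet_normal 2"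
      using eq by (simp add: vec3_eq_iff facet_normal_nth real_sqrt_divide)
  next
    fix x y :: "real^3" assume "x \<in> facet2" "y \<in> reference_tetrahedron"
    then have "(y $ 1 + y $ 2 + y $ 3) - (x $ 1 + x $ 2 + x $ 3) \<le> 0"
      using facet_coordinates(2) by (simp add: reference_tetrahedron_iff)
    moreover have "facet_normal 2 \<bullet> (y - x)
        = ((y $ 1 + y $ 2 + y $ 3) - (x $ 1 + x $ 2 + x $ 3)) / sqrt 3"
      by (simp add: facet_normal_nth inner_vec3 diff_divide_distrib add_divide_distrib)
    ultimately show "facet_normal 2 \<bullet> (y - x) \<le> 0" by (simp add: divide_nonpos_pos)
  qed (simp add: facet_normal_nth norm_vec3_eq_1)
qed

text \<open>The integral over a right triangle with legs of length 2 in collapsed coordinates: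
  \<open>(1 - y) / 2\<close> is the Jacobian, and also the factor in the facet weights apart from
  \<open>c\<close>.\<close>

definition collapsed_integral :: "(real \<Rightarrow> real \<Rightarrow> real) \<Rightarrow> real" where
  "collapsed_integral F = integral {-1..1} (\<lambda>y. integral {-1..1} (\<lambda>x. F x y) * (1 - y)) / 2"

lemma boundary_integral_tetrahedron:
  assumes "continuous_on UNIV g"
  shows "boundary_integral reference_tetrahedron m g =
      facet_normal 1 $ m * collapsed_integral (\<lambda>x y. g (collapsed_map x (-1) y))
    + facet_normal 2 $ m * (sqrt 3 * collapsed_integral (\<lambda>x y. g (collapsed_map 1 x y)))
    + facet_normal 3 $ m * collapsed_integral (\<lambda>x y. g (collapsed_map (-1) x y))
    + facet_normal 4 $ m * collapsed_integral (\<lambda>x y. g (collapsed_map x y (-1)))"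
proof -
  have card: "card tetrahedron_vertices \<ge> 2"
    by (simp add: tetrahedron_vertices_def vec3_eq_iff)
  have sum: "(\<Sum>u\<in>tetrahedron_vertices. f u) = f (vector [-1, -1, -1]) + f (vector [1, -1, -1])
      + f (vector [-1, 1, -1]) + f (vector [-1, -1, 1])" for f :: "real^3 \<Rightarrow> real"
    by (simp add: tetrahedron_vertices_def vec3_eq_iff)
  have duffy:
    "duffy (vector [-1, -1, -1]) (vector [2, 0, 0]) (vector [0, 0, 2]) x y = collapsed_map x (-1) y"
    "duffy (vector [1, -1, -1]) (vector [-2, 2, 0]) (vector [-2, 0, 2]) x y = collapsed_map 1 x y"
    "duffy (vector [-1, -1, -1]) (vector [0, 2, 0]) (vector [0, 0, 2]) x y = collapsed_map (-1) x y"
    "duffy (vector [-1, -1, -1]) (vector [2, 0, 0]) (vector [0, 2, 0]) x y = collapsed_map x y (-1)"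
    for x y
    by (simp_all add: duffy_def vec3_eq_iff collapsed_map_nth field_simps)
  \<comment> \<open>The Gram determinants are 16 on the three coordinate facets and 48 on the
    oblique one. Divided by 8, their roots are 1/2 and \<open>sqrt 3 / 2\<close>; this is the origin
    of \<open>c 2 = sqrt 3\<close>.\<close>
  have s16: "sqrt 16 = 4" by (rule real_sqrt_unique) auto
  have s48: "sqrt 48 = 4 * sqrt 3" using real_sqrt_mult[of 16 3] s16 by simp
  have planar:
    "planar_integral facet1 g = collapsed_integral (\<lambda>x y. g (collapsed_map x (-1) y))"
    "planar_integral facet2 g = sqrt 3 * collapsed_integral (\<lambda>x y. g (collapsed_map 1 x y))"
    "planar_integral facet3 g = collapsed_integral (\<lambda>x y. g (collapsed_map (-1) x y))"
    "planar_integral facet4 g = collapsed_integral (\<lambda>x y. g (collapsed_map x y (-1)))"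
    using assms
    by (simp_all add: planar_integral_triangle inner_vec3 duffy collapsed_integral_def s16 s48)
  show ?thesis
    unfolding boundary_integral_def reference_tetrahedron_eq_hull
      sum_facets_simplex[OF affine_independent_tetrahedron card] sum facets_eq_hull
    unfolding reference_tetrahedron_eq_hull[symmetric] outward_unit_normal_facets planar
    by simp
qed

lemma interior_reference_tetrahedron: "interior reference_tetrahedron \<noteq> {}"
proof -
  \<comment> \<open>The barycenter of the four vertices.\<close>
  let ?c = "vector [-1/2, -1/2, -1/2] :: real^3"
  have "ball ?c (1/8) \<subseteq> reference_tetrahedron"
  proof
    fix x :: "real^3" assume "x \<in> ball ?c (1/8)"
    then have "\<bar>(?c - x) $ i\<bar> < 1/8" for i
      using component_le_norm_cart[of "?c - x" i] by (simp add: dist_norm)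
    from this[of 1] this[of 2] this[of 3] show "x \<in> reference_tetrahedron"
      by (simp add: reference_tetrahedron_iff abs_if split: if_splits)
  qed
  then have "?c \<in> interior reference_tetrahedron"
    by (auto simp: mem_interior intro!: exI[of _ "1/8"])
  then show ?thesis by blast
qed

lemma polytope_reference_tetrahedron: "polytope reference_tetrahedron"
  unfolding polytope_def reference_tetrahedron_eq_hull
  by (rule exI[of _ tetrahedron_vertices]) (simp add: tetrahedron_vertices_def)

section \<open>Tensor products\<close>

lemma lagrange_gram_0: "lagrange_gram q \<eta> 0 a b = 0"
  by (simp add: lagrange_gram_def zero_poly_fun)

lemma lagrange_gram_sym: "lagrange_gram q \<eta> g a b = lagrange_gram q \<eta> g b a"
  by (simp add: lagrange_gram_def mult_ac)

text \<open>Interpolation in one variable is applied three times, from the innermost sum outwards;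
  it suffices that \<open>F\<close> is polynomial in each variable separately.\<close>

lemma tensor_interpolation:
  assumes inj: "inj_on \<eta>1 {0..q1}" "inj_on \<eta>2 {0..q2}" "inj_on \<eta>3 {0..q3}"
    and F: "\<And>y z. polyfun q1 (\<lambda>x. F x y z)" "\<And>x z. polyfun q2 (\<lambda>y. F x y z)"
      "\<And>x y. polyfun q3 (\<lambda>z. F x y z)"
  shows "(\<Sum>a=0..q1. \<Sum>b=0..q2. \<Sum>c=0..q3. lagrange_basis q1 \<eta>1 a x * lagrange_basis q2 \<eta>2 b y
      * lagrange_basis q3 \<eta>3 c z * F (\<eta>1 a) (\<eta>2 b) (\<eta>3 c)) = F x y z"
proof -
  have "(\<Sum>a=0..q1. \<Sum>b=0..q2. \<Sum>c=0..q3. lagrange_basis q1 \<eta>1 a x * lagrange_basis q2 \<eta>2 b y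
      * lagrange_basis q3 \<eta>3 c z * F (\<eta>1 a) (\<eta>2 b) (\<eta>3 c))
    = (\<Sum>a=0..q1. lagrange_basis q1 \<eta>1 a x * (\<Sum>b=0..q2. lagrange_basis q2 \<eta>2 b y
      * (\<Sum>c=0..q3. lagrange_basis q3 \<eta>3 c z * F (\<eta>1 a) (\<eta>2 b) (\<eta>3 c))))"
    by (simp add: sum_distrib_left mult_ac)
  then show ?thesis
    by (simp add: lagrange_interpolation[OF inj(3) F(3)] lagrange_interpolation[OF inj(2) F(2)]
        lagrange_interpolation[OF inj(1) F(1)])
qed

text \<open>The second rule is applied at each fixed first node. After the finite sum is moved under
  the integral, the first rule is exact for every fixed \<open>y\<close>, so polynomial dependence
  on each variable separately is enough.\<close>

lemma collapsed_quadrature: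
  assumes r1: "weighted_rule N1 1 n1 x1 w1" and r2: "weighted_rule N2 [:1, -1:] n2 x2 w2"
    and F: "\<And>y. polyfun N1 (\<lambda>x. F x y)" "\<And>x. polyfun N2 (\<lambda>y. F x y)"
  shows "(\<Sum>i=0..n1. \<Sum>j=0..n2. F (x1 i) (x2 j) * (w1 i * w2 j)) = 2 * collapsed_integral F"
proof -
  have "(\<Sum>i=0..n1. \<Sum>j=0..n2. F (x1 i) (x2 j) * (w1 i * w2 j))
      = (\<Sum>i=0..n1. w1 i * (\<Sum>j=0..n2. F (x1 i) (x2 j) * w2 j))"
    by (simp add: sum_distrib_left mult_ac)
  also have "\<dots> = (\<Sum>i=0..n1. w1 i * integral {-1..1} (\<lambda>y. F (x1 i) y * (1 - y)))"
    by (simp add: weighted_rule_polyfun[OF r2 F(2)])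
  also have "\<dots> = (\<Sum>i=0..n1. integral {-1..1} (\<lambda>y. w1 i * (F (x1 i) y * (1 - y))))"
    by simp
  also have "\<dots> = integral {-1..1} (\<lambda>y. \<Sum>i=0..n1. w1 i * (F (x1 i) y * (1 - y)))"
    by (rule integral_sum[symmetric])
       (auto intro!: integrable_continuous_interval continuous_intros polyfun_continuous[OF F(2)])
  also have "(\<lambda>y. \<Sum>i=0..n1. w1 i * (F (x1 i) y * (1 - y)))
      = (\<lambda>y. integral {-1..1} (\<lambda>x. F x y) * (1 - y))"
  proof
    fix y
    have "(\<Sum>i=0..n1. w1 i * (F (x1 i) y * (1 - y))) = (\<Sum>i=0..n1. F (x1 i) y * w1 i) * (1 - y)"
      by (simp add: sum_distrib_left mult_ac)
    also have "(\<Sum>i=0..n1. F (x1 i) y * w1 i) = integral {-1..1} (\<lambda>x. F x y)"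
      using weighted_rule_polyfun[OF r1 F(1)] by simp
    finally show "(\<Sum>i=0..n1. w1 i * (F (x1 i) y * (1 - y)))
      = integral {-1..1} (\<lambda>x. F x y) * (1 - y)" .
  qed
  finally show ?thesis by (simp add: collapsed_integral_def)
qed

lemma sum_UNIV_reindex3:
  assumes "bij_betw \<sigma> ({0..q1} \<times> {0..q2} \<times> {0..q3}) (UNIV :: 'n::finite set)"
  shows "(\<Sum>i\<in>UNIV. g i) = (\<Sum>a=0..q1. \<Sum>b=0..q2. \<Sum>c=0..q3. g (\<sigma> (a, b, c)))"
  by (simp add: sum.reindex_bij_betw[OF assms, symmetric] sum.cartesian_product case_prod_unfold)

lemma sum_UNIV_reindex2:
  assumes "bij_betw \<sigma> ({0..q1} \<times> {0..q2}) (UNIV :: 'n::finite set)"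
  shows "(\<Sum>i\<in>UNIV. g i) = (\<Sum>a=0..q1. \<Sum>b=0..q2. g (\<sigma> (a, b)))"
  by (simp add: sum.reindex_bij_betw[OF assms, symmetric] sum.cartesian_product case_prod_unfold)

text \<open>With \<open>Q = W ** D\<close> and \<open>r = p\<close>, the definition reduces to
  conditions on entries and nodal values.\<close>

lemma diagonal_norm_SBP_operatorI:
  fixes W D E :: "real^'n::finite^'n"
  assumes \<Omega>: "polytope \<Omega>" "interior \<Omega> \<noteq> {}" "inj \<xi>" "range \<xi> \<subseteq> \<Omega>"
    and pos: "\<And>i. \<omega> i > 0" and W: "W = (\<chi> i j. \<omega> i * of_bool (i = j))"
    and deriv: "\<And>V i. V \<in> poly_space p \<Longrightarrow> (\<Sum>j\<in>UNIV. D $ i $ j * V (\<xi> j)) = partial_deriv m V (\<xi> i)"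
    and sbp: "\<And>i j. \<omega> i * D $ i $ j + \<omega> j * D $ j $ i = E $ i $ j"
    and bdry: "\<And>U V. U \<in> poly_space p \<Longrightarrow> V \<in> poly_space p \<Longrightarrow>
      nodal_values \<xi> U \<bullet> (E *v nodal_values \<xi> V) = boundary_integral \<Omega> m (\<lambda>x. U x * V x)"
  shows "diagonal_norm_nodal_SBP_operator \<Omega> \<xi> m p D W E"
proof -
  have delta: "(\<Sum>j\<in>UNIV. c * of_bool (i = j) * h j) = c * h i" for c i and h :: "'n \<Rightarrow> real"
    by (simp add: of_bool_def if_distrib if_distribR sum.delta cong: if_cong)
  have Wx: "(W *v x) $ i = \<omega> i * x $ i" for x i
    by (simp add: W matrix_vector_mult_def delta)
  have WD: "(W ** D) $ i $ j = \<omega> i * D $ i $ j" for i j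
    by (simp add: W matrix_matrix_mult_def delta)
  have "symmetric_positive_definite W"
    unfolding symmetric_positive_definite_def
  proof (intro conjI allI impI)
    show "transpose W = W" by (auto simp: W transpose_def vec_eq_iff)
    fix x :: "real^'n" assume "x \<noteq> 0"
    then obtain k where "x $ k \<noteq> 0" by (auto simp: vec_eq_iff)
    then have "0 < (\<Sum>i\<in>UNIV. \<omega> i * (x $ i)\<^sup>2)"
      using pos by (intro sum_pos2[of _ k]) (auto simp: less_imp_le)
    then show "x \<bullet> (W *v x) > 0"
      by (simp add: inner_vec_def Wx power2_eq_square mult_ac)
  qed
  moreover have "D = matrix_inv W ** (W ** D)"
  proof -
    \<comment> \<open>\<open>matrix_inv\<close> is defined by choice, so a two-sided inverse has to
      be exhibited before \<open>matrix_inv W\<close> can be used as one.\<close>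
    let ?W' = "(\<chi> i j. 1 / \<omega> i * of_bool (i = j)) :: real^'n^'n"
    have pos': "\<omega> i \<noteq> 0" for i using pos[of i] by simp
    have "(?W' ** W) $ i $ j = 1 / \<omega> i * (\<omega> i * of_bool (i = j))"
      "(W ** ?W') $ i $ j = \<omega> i * (1 / \<omega> i * of_bool (i = j))" for i j
      unfolding W matrix_matrix_mult_def by (simp_all only: vec_lambda_beta delta)
    then have "(?W' ** W) $ i $ j = mat 1 $ i $ j" "(W ** ?W') $ i $ j = mat 1 $ i $ j" for i j
      using pos'[of i] by (simp_all add: mat_def)
    then have "?W' ** W = mat 1" "W ** ?W' = mat 1" by (simp_all add: vec_eq_iff)
    then have "\<exists>A'. W ** A' = mat 1 \<and> A' ** W = mat 1" by blast
    then have "matrix_inv W ** W = mat 1" unfolding matrix_inv_def by (rule someI2_ex) blast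
    then show ?thesis by (simp add: matrix_mul_assoc)
  qed
  moreover have "W ** D + transpose (W ** D) = E"
    by (simp add: vec_eq_iff WD transpose_def sbp)
  moreover have "D *v nodal_values \<xi> V = nodal_values \<xi> (partial_deriv m V)" if "V \<in> poly_space p" for V
    using deriv[OF that] by (simp add: vec_eq_iff matrix_vector_mult_def nodal_values_def)
  moreover have "diagonal_matrix W" by (simp add: W diagonal_matrix_def)
  ultimately show ?thesis
    unfolding diagonal_norm_nodal_SBP_operator_def nodal_SBP_operator_def
    using \<Omega> bdry by blast
qed

lemma inner_transpose_matrix: "x \<bullet> (transpose (R :: real^'n^'f) *v y) = (R *v x) \<bullet> y"
  by (metis dot_lmul_matrix inner_commute transpose_matrix_vector)

lemma diag_sandwich_nth:
  fixes R :: "real^'n^'f"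
  assumes "B = (\<chi> i j. w i * of_bool (i = j))"
  shows "(transpose R ** B ** R) $ i $ j = (\<Sum>f\<in>UNIV. w f * (R $ f $ i * R $ f $ j))"
  by (simp add: assms matrix_matrix_mult_def transpose_def of_bool_def if_distrib if_distribR sum.delta'
      mult_ac cong: if_cong)

text \<open>For nodal values \<open>x\<close> and \<open>y\<close> this is the facet quadrature sum
  of the product of the two extrapolated functions.\<close>

lemma diag_sandwich_inner:
  fixes R :: "real^'n^'f"
  assumes "B = (\<chi> i j. w i * of_bool (i = j))"
  shows "x \<bullet> ((transpose R ** B ** R) *v y) = (\<Sum>f\<in>UNIV. w f * ((R *v x) $ f * (R *v y) $ f))"
proof -
  have "(B *v z) $ f = w f * z $ f" for z f
    by (simp add: assms matrix_vector_mult_def of_bool_def if_distrib if_distribR sum.delta cong: if_cong)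
  moreover have "x \<bullet> ((transpose R ** B ** R) *v y) = (R *v x) \<bullet> (B *v (R *v y))"
    by (simp only: inner_transpose_matrix flip: matrix_vector_mul_assoc)
  ultimately show ?thesis by (simp add: inner_vec_def mult_ac)
qed

text \<open>Here and in \<open>collapsed_inverse_jacobian\<close> the letters stand for \<open>x = 1 + \<eta>\<^sub>1\<close>, \<open>y = 1 - \<eta>\<^sub>2\<close>,
  \<open>u = 1 + \<eta>\<^sub>2 = 2 - y\<close> and \<open>z = 1 - \<eta>\<^sub>3\<close>.\<close>

lemma weighted_entry_1:
  fixes y z :: real
  assumes "y \<noteq> 0" "z \<noteq> 0"
  shows "1/8 * y * z * w1 * w2 * w3 * (4 / (y * z) * d1 * p2 * p3)
    = 1/2 * (w1 * d1) * (w2 * p2) * (w3 * p3)"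
  using assms by (simp add: field_simps)

lemma weighted_entry_2:
  fixes y z :: real
  assumes "y \<noteq> 0" "z \<noteq> 0"
  shows "1/8 * y * z * w1 * w2 * w3 * (2 * x / (y * z) * d1 * p2 * p3 + 2 / z * p1 * d2 * p3)
    = 1/4 * (x * w1 * d1) * (w2 * p2) * (w3 * p3) + 1/4 * (w1 * p1) * (y * w2 * d2) * (w3 * p3)"
  using assms by (simp add: field_simps)

lemma weighted_entry_3:
  fixes y z :: real
  assumes "y \<noteq> 0" "z \<noteq> 0"
  shows "1/8 * y * z * w1 * w2 * w3
      * (2 * x / (y * z) * d1 * p2 * p3 + u / z * p1 * d2 * p3 + p1 * p2 * d3)
    = 1/4 * (x * w1 * d1) * (w2 * p2) * (w3 * p3) + 1/8 * (w1 * p1) * (y * u * w2 * d2) * (w3 * p3)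
      + 1/8 * (w1 * p1) * (y * w2 * p2) * (z * w3 * d3)"
  using assms by (simp add: field_simps)

lemma sum_of_bool_mult: "b \<le> (q :: nat) \<Longrightarrow> (\<Sum>x=0..q. of_bool (b = x) * h x) = (h b :: real)"
  by (simp add: of_bool_def if_distrib if_distribR sum.delta cong: if_cong)

lemma sum_delta_23:
  fixes q1 q2 q3 :: nat
  assumes "b \<le> q2" "c \<le> q3"
  shows "(\<Sum>x=0..q1. \<Sum>y=0..q2. \<Sum>z=0..(q3::nat). K * d x * of_bool (b = y) * of_bool (c = z) * G x y z)
    = K * (\<Sum>x=0..(q1::nat). d x * (G x b c :: real))"
proof -
  have "(\<Sum>x=0..q1. \<Sum>y=0..q2. \<Sum>z=0..(q3::nat). K * d x * of_bool (b = y) * of_bool (c = z) * G x y z)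
    = (\<Sum>x=0..q1. K * d x * (\<Sum>y=0..q2. of_bool (b = y) * (\<Sum>z=0..q3. of_bool (c = z) * G x y z)))"
    by (simp only: sum_distrib_left mult.assoc)
  also have "\<dots> = K * (\<Sum>x=0..q1. d x * G x b c)"
    using assms by (simp only: sum_of_bool_mult mult.assoc flip: sum_distrib_left)
  finally show ?thesis .
qed

lemma sum_delta_13:
  fixes q1 q2 q3 :: nat
  assumes "a \<le> q1" "c \<le> q3"
  shows "(\<Sum>x=0..q1. \<Sum>y=0..q2. \<Sum>z=0..(q3::nat). K * of_bool (a = x) * d y * of_bool (c = z) * G x y z)
    = K * (\<Sum>y=0..(q2::nat). d y * (G a y c :: real))"
proof -
  have "(\<Sum>x=0..q1. \<Sum>y=0..q2. \<Sum>z=0..(q3::nat). K * of_bool (a = x) * d y * of_bool (c = z) * G x y z)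
    = K * (\<Sum>x=0..q1. of_bool (a = x) * (\<Sum>y=0..q2. d y * (\<Sum>z=0..q3. of_bool (c = z) * G x y z)))"
    by (simp only: sum_distrib_left mult.assoc)
  also have "\<dots> = K * (\<Sum>y=0..q2. d y * G a y c)"
    using assms by (simp only: sum_of_bool_mult)
  finally show ?thesis .
qed

lemma sum_delta_12:
  fixes q1 q2 q3 :: nat
  assumes "a \<le> q1" "b \<le> q2"
  shows "(\<Sum>x=0..q1. \<Sum>y=0..q2. \<Sum>z=0..(q3::nat). of_bool (a = x) * of_bool (b = y) * d z * G x y z)
    = (\<Sum>z=0..q3. d z * (G a b z :: real))"
proof -
  have "(\<Sum>x=0..q1. \<Sum>y=0..q2. \<Sum>z=0..(q3::nat). of_bool (a = x) * of_bool (b = y) * d z * G x y z)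
    = (\<Sum>x=0..q1. of_bool (a = x) * (\<Sum>y=0..q2. of_bool (b = y) * (\<Sum>z=0..q3. d z * G x y z)))"
    by (simp only: sum_distrib_left mult.assoc)
  also have "\<dots> = (\<Sum>z=0..q3. d z * G a b z)"
    using assms by (simp only: sum_of_bool_mult)
  finally show ?thesis .
qed

lemma sum_matrix_vector_mult: "(\<Sum>a\<in>A. M a) *v x = (\<Sum>a\<in>A. M a *v (x :: real^'n))"
  by (induction A rule: infinite_finite_induct) (auto simp: matrix_vector_mult_add_rdistrib)

lemma sum_product_eq:
  assumes "\<And>i j. i \<le> n \<Longrightarrow> j \<le> m \<Longrightarrow> g i j = K * (A i * B j)"
  shows "(\<Sum>i=0..(n::nat). \<Sum>j=0..(m::nat). g i j) = (K :: real) * ((\<Sum>i=0..n. A i) * (\<Sum>j=0..m. B j))"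
proof -
  have "(\<Sum>i=0..n. \<Sum>j=0..m. g i j) = (\<Sum>i=0..n. \<Sum>j=0..m. K * (A i * B j))"
    by (intro sum.cong refl) (use assms in auto)
  then show ?thesis by (subst sum_product) (simp only: sum_distrib_left)
qed

lemma collapsed_inverse_jacobian:
  fixes y z :: real
  assumes "y \<noteq> 0" "z \<noteq> 0"
  shows "4 / (y * z) * (y * z / 4 * P1) = P1"
    and "2 * x / (y * z) * (y * z / 4 * P1) + 2 / z * (- x * z / 4 * P1 + z / 2 * P2) = P2"
    and "2 * x / (y * z) * (y * z / 4 * P1) + (2 - y) / z * (- x * z / 4 * P1 + z / 2 * P2)
      + (- x * y / 4 * P1 - (2 - y) / 2 * P2 + P3) = P3"
  using assms by (simp_all add: field_simps)

text \<open>Matrices are indexed by the finite types \<open>'n\<close> and \<open>'f\<close>, whose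
  sizes are forced by the bijections \<open>\<sigma>\<close> and \<open>\<sigma>f\<close>. The
  exponents \<open>a3\<close> and \<open>af\<close> record which alternative holds for the third
  volume rule and the second facet rule.\<close>

theorem theorem4p3:
  fixes q1 q2 q3 qf1 qf2 q :: nat
    and \<eta>1 \<eta>2 \<eta>3 \<eta>f1 \<eta>f2 :: "nat \<Rightarrow> real"
    and \<omega>1 \<omega>2 \<omega>3 \<omega>f1 \<omega>f2 :: "nat \<Rightarrow> real"
    and a3 af :: nat
    and \<sigma> :: "nat \<times> nat \<times> nat \<Rightarrow> 'n::finite"
    and \<sigma>f :: "nat \<times> nat \<Rightarrow> 'f::finite"
    and I :: "(nat \<times> nat \<times> nat) set" and If :: "(nat \<times> nat) set"
    and \<xi> :: "'n \<Rightarrow> real^3" and \<omega> :: "'n \<Rightarrow> real"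
    and \<xi>f :: "nat \<Rightarrow> 'f \<Rightarrow> real^3" and \<omega>f :: "nat \<Rightarrow> 'f \<Rightarrow> real"
    and D1 D2 D3 W :: "real^'n^'n"
    and R :: "nat \<Rightarrow> real^'n^'f" and B :: "nat \<Rightarrow> real^'f^'f"
    and c :: "nat \<Rightarrow> real"
    and E :: "3 \<Rightarrow> real^'n^'n"
  assumes q: "q = min q1 (min q2 q3)"
    \<comment> \<open>volume rules\<close>
    and nodes_distinct: "inj_on \<eta>1 {0..q1}" "inj_on \<eta>2 {0..q2}" "inj_on \<eta>3 {0..q3}"
    and nodes_range: "\<eta>1 ` {0..q1} \<subseteq> {-1..1}" "\<eta>2 ` {0..q2} \<subseteq> {-1..<1}" "\<eta>3 ` {0..q3} \<subseteq> {-1..<1}"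
    and weights_pos: "\<omega>1 ` {0..q1} \<subseteq> {0<..}" "\<omega>2 ` {0..q2} \<subseteq> {0<..}" "\<omega>3 ` {0..q3} \<subseteq> {0<..}"
    and gaussian: "gaussian_rule 0 0 q1 \<eta>1 \<omega>1" "gaussian_rule 0 0 q2 \<eta>2 \<omega>2"
                  "gaussian_rule a3 0 q3 \<eta>3 \<omega>3"
    and exact1: "quadrature_exact 0 0 (2 * q1) q1 \<eta>1 \<omega>1"
    and exact2: "quadrature_exact 0 0 (2 * q2 + 1) q2 \<eta>2 \<omega>2"
    and exact3: "(a3 = 0 \<and> quadrature_exact 0 0 (2 * q3 + 1) q3 \<eta>3 \<omega>3)
                 \<or> (a3 = 1 \<and> quadrature_exact 1 0 (2 * q3) q3 \<eta>3 \<omega>3)"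
    \<comment> \<open>facet rules\<close>
    and facet_nodes_range: "\<eta>f1 ` {0..qf1} \<subseteq> {-1..1}" "\<eta>f2 ` {0..qf2} \<subseteq> {-1..1}"
    and facet_weights_nonneg: "\<omega>f1 ` {0..qf1} \<subseteq> {0..}" "\<omega>f2 ` {0..qf2} \<subseteq> {0..}"
    and exactf1: "quadrature_exact 0 0 (2 * max q1 q2) qf1 \<eta>f1 \<omega>f1"
    and exactf2: "(af = 0 \<and> quadrature_exact 0 0 (2 * max q2 q3 + 1) qf2 \<eta>f2 \<omega>f2)
                  \<or> (af = 1 \<and> quadrature_exact 1 0 (2 * max q2 q3) qf2 \<eta>f2 \<omega>f2)"
    \<comment> \<open>orderings\<close>
    and I: "I = {0..q1} \<times> {0..q2} \<times> {0..q3}"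
    and If: "If = {0..qf1} \<times> {0..qf2}"
    and \<sigma>: "bij_betw \<sigma> I UNIV"
    and \<sigma>f: "bij_betw \<sigma>f If UNIV"
    \<comment> \<open>volume nodes and weights\<close>
    and \<xi>: "\<And>\<alpha>1 \<alpha>2 \<alpha>3. (\<alpha>1, \<alpha>2, \<alpha>3) \<in> I \<Longrightarrow>
          \<xi> (\<sigma> (\<alpha>1, \<alpha>2, \<alpha>3)) = collapsed_map (\<eta>1 \<alpha>1) (\<eta>2 \<alpha>2) (\<eta>3 \<alpha>3)"
    and \<omega>: "\<And>\<alpha>1 \<alpha>2 \<alpha>3. (\<alpha>1, \<alpha>2, \<alpha>3) \<in> I \<Longrightarrow>
          \<omega> (\<sigma> (\<alpha>1, \<alpha>2, \<alpha>3)) =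
            (if a3 = 0 then 1/8 * (1 - \<eta>2 \<alpha>2) * (1 - \<eta>3 \<alpha>3)\<^sup>2 * \<omega>1 \<alpha>1 * \<omega>2 \<alpha>2 * \<omega>3 \<alpha>3
             else 1/8 * (1 - \<eta>2 \<alpha>2) * (1 - \<eta>3 \<alpha>3) * \<omega>1 \<alpha>1 * \<omega>2 \<alpha>2 * \<omega>3 \<alpha>3)"
    and W: "W = (\<chi> i j. \<omega> i * of_bool (i = j))"
    \<comment> \<open>facet nodes, weights and operators\<close>
    and \<xi>f: "\<And>\<alpha>1 \<alpha>2. (\<alpha>1, \<alpha>2) \<in> If \<Longrightarrow> \<xi>f 1 (\<sigma>f (\<alpha>1, \<alpha>2)) = collapsed_map (\<eta>f1 \<alpha>1) (-1) (\<eta>f2 \<alpha>2)"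
            "\<And>\<alpha>1 \<alpha>2. (\<alpha>1, \<alpha>2) \<in> If \<Longrightarrow> \<xi>f 2 (\<sigma>f (\<alpha>1, \<alpha>2)) = collapsed_map 1 (\<eta>f1 \<alpha>1) (\<eta>f2 \<alpha>2)"
            "\<And>\<alpha>1 \<alpha>2. (\<alpha>1, \<alpha>2) \<in> If \<Longrightarrow> \<xi>f 3 (\<sigma>f (\<alpha>1, \<alpha>2)) = collapsed_map (-1) (\<eta>f1 \<alpha>1) (\<eta>f2 \<alpha>2)"
            "\<And>\<alpha>1 \<alpha>2. (\<alpha>1, \<alpha>2) \<in> If \<Longrightarrow> \<xi>f 4 (\<sigma>f (\<alpha>1, \<alpha>2)) = collapsed_map (\<eta>f1 \<alpha>1) (\<eta>f2 \<alpha>2) (-1)"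
    and c: "c 1 = 1" "c 2 = sqrt 3" "c 3 = 1" "c 4 = 1"
    and \<omega>f: "\<And>\<zeta> \<alpha>1 \<alpha>2. \<zeta> \<in> {1..4} \<Longrightarrow> (\<alpha>1, \<alpha>2) \<in> If \<Longrightarrow>
          \<omega>f \<zeta> (\<sigma>f (\<alpha>1, \<alpha>2)) =
            (if af = 0 then c \<zeta> * (1/2) * (1 - \<eta>f2 \<alpha>2) * \<omega>f1 \<alpha>1 * \<omega>f2 \<alpha>2
             else c \<zeta> * (1/2) * \<omega>f1 \<alpha>1 * \<omega>f2 \<alpha>2)"
    and B: "\<And>\<zeta>. \<zeta> \<in> {1..4} \<Longrightarrow> B \<zeta> = (\<chi> i j. \<omega>f \<zeta> i * of_bool (i = j))"
    and R: "\<And>\<alpha>1 \<alpha>2 \<beta>1 \<beta>2 \<beta>3. (\<alpha>1, \<alpha>2) \<in> If \<Longrightarrow> (\<beta>1, \<beta>2, \<beta>3) \<in> I \<Longrightarrow>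
              R 1 $ \<sigma>f (\<alpha>1, \<alpha>2) $ \<sigma> (\<beta>1, \<beta>2, \<beta>3) =
                lagrange_basis q1 \<eta>1 \<beta>1 (\<eta>f1 \<alpha>1) * lagrange_basis q2 \<eta>2 \<beta>2 (-1)
                  * lagrange_basis q3 \<eta>3 \<beta>3 (\<eta>f2 \<alpha>2)"
           "\<And>\<alpha>1 \<alpha>2 \<beta>1 \<beta>2 \<beta>3. (\<alpha>1, \<alpha>2) \<in> If \<Longrightarrow> (\<beta>1, \<beta>2, \<beta>3) \<in> I \<Longrightarrow>
              R 2 $ \<sigma>f (\<alpha>1, \<alpha>2) $ \<sigma> (\<beta>1, \<beta>2, \<beta>3) =
                lagrange_basis q1 \<eta>1 \<beta>1 1 * lagrange_basis q2 \<eta>2 \<beta>2 (\<eta>f1 \<alpha>1)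
                  * lagrange_basis q3 \<eta>3 \<beta>3 (\<eta>f2 \<alpha>2)"
           "\<And>\<alpha>1 \<alpha>2 \<beta>1 \<beta>2 \<beta>3. (\<alpha>1, \<alpha>2) \<in> If \<Longrightarrow> (\<beta>1, \<beta>2, \<beta>3) \<in> I \<Longrightarrow>
              R 3 $ \<sigma>f (\<alpha>1, \<alpha>2) $ \<sigma> (\<beta>1, \<beta>2, \<beta>3) =
                lagrange_basis q1 \<eta>1 \<beta>1 (-1) * lagrange_basis q2 \<eta>2 \<beta>2 (\<eta>f1 \<alpha>1)
                  * lagrange_basis q3 \<eta>3 \<beta>3 (\<eta>f2 \<alpha>2)"
           "\<And>\<alpha>1 \<alpha>2 \<beta>1 \<beta>2 \<beta>3. (\<alpha>1, \<alpha>2) \<in> If \<Longrightarrow> (\<beta>1, \<beta>2, \<beta>3) \<in> I \<Longrightarrow>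
              R 4 $ \<sigma>f (\<alpha>1, \<alpha>2) $ \<sigma> (\<beta>1, \<beta>2, \<beta>3) =
                lagrange_basis q1 \<eta>1 \<beta>1 (\<eta>f1 \<alpha>1) * lagrange_basis q2 \<eta>2 \<beta>2 (\<eta>f2 \<alpha>2)
                  * lagrange_basis q3 \<eta>3 \<beta>3 (-1)"
    and E: "\<And>m. E m = (\<Sum>\<zeta>=1..4. facet_normal \<zeta> $ m *\<^sub>R (transpose (R \<zeta>) ** B \<zeta> ** R \<zeta>))"
    \<comment> \<open>derivative operators\<close>
    and D1: "\<And>\<alpha>1 \<alpha>2 \<alpha>3 \<beta>1 \<beta>2 \<beta>3. (\<alpha>1, \<alpha>2, \<alpha>3) \<in> I \<Longrightarrow> (\<beta>1, \<beta>2, \<beta>3) \<in> I \<Longrightarrow>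
          D1 $ \<sigma> (\<alpha>1, \<alpha>2, \<alpha>3) $ \<sigma> (\<beta>1, \<beta>2, \<beta>3) =
            4 / ((1 - \<eta>2 \<alpha>2) * (1 - \<eta>3 \<alpha>3)) * deriv (lagrange_basis q1 \<eta>1 \<beta>1) (\<eta>1 \<alpha>1)
              * of_bool (\<alpha>2 = \<beta>2) * of_bool (\<alpha>3 = \<beta>3)"
    and D2: "\<And>\<alpha>1 \<alpha>2 \<alpha>3 \<beta>1 \<beta>2 \<beta>3. (\<alpha>1, \<alpha>2, \<alpha>3) \<in> I \<Longrightarrow> (\<beta>1, \<beta>2, \<beta>3) \<in> I \<Longrightarrow>
          D2 $ \<sigma> (\<alpha>1, \<alpha>2, \<alpha>3) $ \<sigma> (\<beta>1, \<beta>2, \<beta>3) =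
            2 * (1 + \<eta>1 \<alpha>1) / ((1 - \<eta>2 \<alpha>2) * (1 - \<eta>3 \<alpha>3))
              * deriv (lagrange_basis q1 \<eta>1 \<beta>1) (\<eta>1 \<alpha>1) * of_bool (\<alpha>2 = \<beta>2) * of_bool (\<alpha>3 = \<beta>3)
            + 2 / (1 - \<eta>3 \<alpha>3)
              * of_bool (\<alpha>1 = \<beta>1) * deriv (lagrange_basis q2 \<eta>2 \<beta>2) (\<eta>2 \<alpha>2) * of_bool (\<alpha>3 = \<beta>3)"
    and D3: "\<And>\<alpha>1 \<alpha>2 \<alpha>3 \<beta>1 \<beta>2 \<beta>3. (\<alpha>1, \<alpha>2, \<alpha>3) \<in> I \<Longrightarrow> (\<beta>1, \<beta>2, \<beta>3) \<in> I \<Longrightarrow>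
          D3 $ \<sigma> (\<alpha>1, \<alpha>2, \<alpha>3) $ \<sigma> (\<beta>1, \<beta>2, \<beta>3) =
            2 * (1 + \<eta>1 \<alpha>1) / ((1 - \<eta>2 \<alpha>2) * (1 - \<eta>3 \<alpha>3))
              * deriv (lagrange_basis q1 \<eta>1 \<beta>1) (\<eta>1 \<alpha>1) * of_bool (\<alpha>2 = \<beta>2) * of_bool (\<alpha>3 = \<beta>3)
            + (1 + \<eta>2 \<alpha>2) / (1 - \<eta>3 \<alpha>3)
              * of_bool (\<alpha>1 = \<beta>1) * deriv (lagrange_basis q2 \<eta>2 \<beta>2) (\<eta>2 \<alpha>2) * of_bool (\<alpha>3 = \<beta>3)
            + of_bool (\<alpha>1 = \<beta>1) * of_bool (\<alpha>2 = \<beta>2) * deriv (lagrange_basis q3 \<eta>3 \<beta>3) (\<eta>3 \<alpha>3)"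
  shows "diagonal_norm_nodal_SBP_operator reference_tetrahedron \<xi> 1 q D1 W (E 1)
       \<and> diagonal_norm_nodal_SBP_operator reference_tetrahedron \<xi> 2 q D2 W (E 2)
       \<and> diagonal_norm_nodal_SBP_operator reference_tetrahedron \<xi> 3 q D3 W (E 3)
       \<and> (\<forall>\<zeta>\<in>{1..4}. \<exists>r\<ge>q. interp_extrap_operator \<xi> (\<xi>f \<zeta>) r (R \<zeta>))"
proof -
  define w3 where "w3 = (\<lambda>i. if a3 = 0 then (1 - \<eta>3 i) * \<omega>3 i else \<omega>3 i)"
  define wf2 where "wf2 = (\<lambda>i. if af = 0 then (1 - \<eta>f2 i) * \<omega>f2 i else \<omega>f2 i)"
  have r1: "weighted_rule (2 * q1) 1 q1 \<eta>1 \<omega>1" by (rule weighted_rule_1[OF exact1])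
  have r2: "weighted_rule (2 * q2 + 1) 1 q2 \<eta>2 \<omega>2" by (rule weighted_rule_1[OF exact2])
  have r3: "weighted_rule (2 * q3) [:1, -1:] q3 \<eta>3 w3"
    unfolding w3_def by (rule weighted_rule_absorb[OF exact3])
  have rf1: "weighted_rule (2 * max q1 q2) 1 qf1 \<eta>f1 \<omega>f1" by (rule weighted_rule_1[OF exactf1])
  have rf2: "weighted_rule (2 * max q2 q3) [:1, -1:] qf2 \<eta>f2 wf2"
    unfolding wf2_def by (rule weighted_rule_absorb[OF exactf2])
  have qle: "q \<le> q1" "q \<le> q2" "q \<le> q3" by (simp_all add: q)
  note reindex = sum_UNIV_reindex3[OF \<sigma>[unfolded I]] and reindexf = sum_UNIV_reindex2[OF \<sigma>f[unfolded If]]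
  have Imem: "(a, b, c) \<in> I \<longleftrightarrow> a \<le> q1 \<and> b \<le> q2 \<and> c \<le> q3" for a b c by (simp add: I)
  have Ifmem: "(a, b) \<in> If \<longleftrightarrow> a \<le> qf1 \<and> b \<le> qf2" for a b by (simp add: If)
  have index: "\<exists>a b c. a \<le> q1 \<and> b \<le> q2 \<and> c \<le> q3 \<and> i = \<sigma> (a, b, c)" for i
  proof -
    have "i \<in> \<sigma> ` I" using \<sigma> by (simp add: bij_betw_def)
    then show ?thesis using Imem by fastforce
  qed
  have indexf: "\<exists>a b. a \<le> qf1 \<and> b \<le> qf2 \<and> f = \<sigma>f (a, b)" for f
  proof -
    have "f \<in> \<sigma>f ` If" using \<sigma>f by (simp add: bij_betw_def)
    then show ?thesis using Ifmem by fastforce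
  qed
  have nz: "1 - \<eta>2 b \<noteq> 0" "1 - \<eta>3 c \<noteq> 0" "0 < 1 - \<eta>2 b" "0 < 1 - \<eta>3 c" "\<eta>2 b < 1" "\<eta>3 c < 1"
    if "b \<le> q2" "c \<le> q3" for b c
    using nodes_range(2,3) that by (auto simp: image_subset_iff dest!: bspec)
  \<comment> \<open>Once \<open>w3\<close> has absorbed one factor \<open>1 - \<eta>3\<close> where
    necessary, both alternatives give the same formula. The other factor remains to cancel the
    denominators of the derivative operators.\<close>
  have wt: "\<omega> (\<sigma> (a, b, c)) = 1/8 * (1 - \<eta>2 b) * (1 - \<eta>3 c) * \<omega>1 a * \<omega>2 b * w3 c"
    if "a \<le> q1" "b \<le> q2" "c \<le> q3" for a b c
    using that by (simp add: \<omega> Imem w3_def power2_eq_square)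
  have wtf: "\<omega>f \<zeta> (\<sigma>f (i, j)) = c \<zeta> / 2 * (\<omega>f1 i * wf2 j)"
    if "\<zeta> \<in> {1..4}" "i \<le> qf1" "j \<le> qf2" for \<zeta> i j
    using that by (simp add: \<omega>f Ifmem wf2_def)
  have wpos: "\<omega> i > 0" for i
  proof -
    obtain a b c where i: "a \<le> q1" "b \<le> q2" "c \<le> q3" "i = \<sigma> (a, b, c)" using index by blast
    have "0 < \<omega>1 a" "0 < \<omega>2 b" "0 < \<omega>3 c"
      using weights_pos i by (auto simp: image_subset_iff)
    then show ?thesis using i nz[OF i(2,3)] by (simp add: wt w3_def)
  qed
  have inj_\<xi>: "inj \<xi>"
  proof (rule injI)
    fix i j assume eq: "\<xi> i = \<xi> j"
    obtain a b c where i: "a \<le> q1" "b \<le> q2" "c \<le> q3" "i = \<sigma> (a, b, c)" using index by blast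
    obtain a' b' c' where j: "a' \<le> q1" "b' \<le> q2" "c' \<le> q3" "j = \<sigma> (a', b', c')" using index by blast
    have "collapsed_map (\<eta>1 a) (\<eta>2 b) (\<eta>3 c) = collapsed_map (\<eta>1 a') (\<eta>2 b') (\<eta>3 c')"
      using eq i j by (simp add: \<xi> Imem)
    then have "\<eta>1 a = \<eta>1 a' \<and> \<eta>2 b = \<eta>2 b' \<and> \<eta>3 c = \<eta>3 c'"
      by (rule collapsed_map_inj) (use nz i in auto)
    then have "a = a' \<and> b = b' \<and> c = c'"
      using nodes_distinct i j by (simp add: inj_on_def)
    then show "i = j" using i j by simp
  qed
  have range_\<xi>: "range \<xi> \<subseteq> reference_tetrahedron"
  proof safe
    fix i
    obtain a b c where i: "a \<le> q1" "b \<le> q2" "c \<le> q3" "i = \<sigma> (a, b, c)" using index by blast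
    have "\<eta>1 a \<in> {-1..1}" "\<eta>2 b \<in> {-1..<1}" "\<eta>3 c \<in> {-1..<1}"
      using nodes_range i unfolding image_subset_iff by auto
    then show "\<xi> i \<in> reference_tetrahedron"
      using i by (auto simp: \<xi> Imem intro!: collapsed_map_in_tetrahedron)
  qed

  have pf: "polyfun q1 (\<lambda>x. V (collapsed_map x y z))" "polyfun q2 (\<lambda>y. V (collapsed_map x y z))"
    "polyfun q3 (\<lambda>z. V (collapsed_map x y z))" if "V \<in> poly_space q" for V x y z
    using polyfun_collapsed_map[OF that] polyfun_mono qle by blast+

  \<comment> \<open>Exactness of the derivative operators on polynomials of degree
    \<open>q\<close>\<close>
  have deriv1: "(\<Sum>j\<in>UNIV. D1 $ i $ j * V (\<xi> j)) = partial_deriv 1 V (\<xi> i)"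
    and deriv2: "(\<Sum>j\<in>UNIV. D2 $ i $ j * V (\<xi> j)) = partial_deriv 2 V (\<xi> i)"
    and deriv3: "(\<Sum>j\<in>UNIV. D3 $ i $ j * V (\<xi> j)) = partial_deriv 3 V (\<xi> i)"
    if V: "V \<in> poly_space q" for V i
  proof -
    obtain a b c where i: "a \<le> q1" "b \<le> q2" "c \<le> q3" "i = \<sigma> (a, b, c)" using index by blast
    define F where "F = (\<lambda>x y z. V (collapsed_map x y z))"
    let ?y = "1 - \<eta>2 b" and ?z = "1 - \<eta>3 c"
    define l1 where "l1 = (\<lambda>x. deriv (lagrange_basis q1 \<eta>1 x) (\<eta>1 a))"
    define l2 where "l2 = (\<lambda>x. deriv (lagrange_basis q2 \<eta>2 x) (\<eta>2 b))"
    define l3 where "l3 = (\<lambda>x. deriv (lagrange_basis q3 \<eta>3 x) (\<eta>3 c))"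
    let ?G = "\<lambda>x y z. F (\<eta>1 x) (\<eta>2 y) (\<eta>3 z)"
    have sum1: "(\<Sum>x=0..q1. l1 x * ?G x b c) = deriv (\<lambda>x. V (collapsed_map x (\<eta>2 b) (\<eta>3 c))) (\<eta>1 a)"
      unfolding l1_def F_def by (rule lagrange_interpolation_deriv[OF nodes_distinct(1) pf(1)[OF V]])
    have sum2: "(\<Sum>y=0..q2. l2 y * ?G a y c) = deriv (\<lambda>y. V (collapsed_map (\<eta>1 a) y (\<eta>3 c))) (\<eta>2 b)"
      unfolding l2_def F_def by (rule lagrange_interpolation_deriv[OF nodes_distinct(2) pf(2)[OF V]])
    have sum3: "(\<Sum>z=0..q3. l3 z * ?G a b z) = deriv (\<lambda>z. V (collapsed_map (\<eta>1 a) (\<eta>2 b) z)) (\<eta>3 c)"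
      unfolding l3_def F_def by (rule lagrange_interpolation_deriv[OF nodes_distinct(3) pf(3)[OF V]])
    note chain = collapsed_map_chain_rule[OF V]
    have \<xi>i: "\<xi> i = collapsed_map (\<eta>1 a) (\<eta>2 b) (\<eta>3 c)" using i by (simp add: \<xi> Imem)
    have F\<xi>: "V (\<xi> (\<sigma> (x, y, z))) = ?G x y z" if "x \<le> q1" "y \<le> q2" "z \<le> q3" for x y z
      using that by (simp add: \<xi> Imem F_def)
    \<comment> \<open>The coefficients in the rows of \<open>D1\<close>, \<open>D2\<close>,
      \<open>D3\<close> are those that invert the triangular system of the chain rule.\<close>
    note inverse_jacobian = collapsed_inverse_jacobian[OF nz(1,2)[OF i(2,3)]]
    have "(\<Sum>j\<in>UNIV. D1 $ i $ j * V (\<xi> j))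
        = (\<Sum>x=0..q1. \<Sum>y=0..q2. \<Sum>z=0..q3.
            4 / (?y * ?z) * l1 x * of_bool (b = y) * of_bool (c = z) * ?G x y z)"
      unfolding reindex by (intro sum.cong refl) (use i in \<open>simp add: D1 Imem F\<xi> l1_def\<close>)
    also have "\<dots> = 4 / (?y * ?z) * deriv (\<lambda>x. V (collapsed_map x (\<eta>2 b) (\<eta>3 c))) (\<eta>1 a)"
      using i sum1 by (simp only: sum_delta_23)
    finally show "(\<Sum>j\<in>UNIV. D1 $ i $ j * V (\<xi> j)) = partial_deriv 1 V (\<xi> i)"
      unfolding chain \<xi>i inverse_jacobian .
    have "(\<Sum>j\<in>UNIV. D2 $ i $ j * V (\<xi> j))
        = (\<Sum>x=0..q1. \<Sum>y=0..q2. \<Sum>z=0..q3.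
            2 * (1 + \<eta>1 a) / (?y * ?z) * l1 x * of_bool (b = y) * of_bool (c = z) * ?G x y z
          + 2 / ?z * of_bool (a = x) * l2 y * of_bool (c = z) * ?G x y z)"
      unfolding reindex
      by (intro sum.cong refl) (use i in \<open>simp add: D2 Imem F\<xi> l1_def l2_def distrib_right\<close>)
    also have "\<dots> = 2 * (1 + \<eta>1 a) / (?y * ?z) * deriv (\<lambda>x. V (collapsed_map x (\<eta>2 b) (\<eta>3 c))) (\<eta>1 a)
        + 2 / ?z * deriv (\<lambda>y. V (collapsed_map (\<eta>1 a) y (\<eta>3 c))) (\<eta>2 b)"
      using i sum1 sum2 by (simp only: sum.distrib sum_delta_23 sum_delta_13)
    finally show "(\<Sum>j\<in>UNIV. D2 $ i $ j * V (\<xi> j)) = partial_deriv 2 V (\<xi> i)"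
      unfolding chain \<xi>i inverse_jacobian .
    have u: "1 + \<eta>2 b = 2 - ?y" by simp
    have "(\<Sum>j\<in>UNIV. D3 $ i $ j * V (\<xi> j))
        = (\<Sum>x=0..q1. \<Sum>y=0..q2. \<Sum>z=0..q3.
            2 * (1 + \<eta>1 a) / (?y * ?z) * l1 x * of_bool (b = y) * of_bool (c = z) * ?G x y z
          + (1 + \<eta>2 b) / ?z * of_bool (a = x) * l2 y * of_bool (c = z) * ?G x y z
          + of_bool (a = x) * of_bool (b = y) * l3 z * ?G x y z)"
      unfolding reindex
      by (intro sum.cong refl) (use i in \<open>simp add: D3 Imem F\<xi> l1_def l2_def l3_def distrib_right\<close>)
    also have "\<dots> = 2 * (1 + \<eta>1 a) / (?y * ?z) * deriv (\<lambda>x. V (collapsed_map x (\<eta>2 b) (\<eta>3 c))) (\<eta>1 a)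
        + (1 + \<eta>2 b) / ?z * deriv (\<lambda>y. V (collapsed_map (\<eta>1 a) y (\<eta>3 c))) (\<eta>2 b)
        + deriv (\<lambda>z. V (collapsed_map (\<eta>1 a) (\<eta>2 b) z)) (\<eta>3 c)"
      using i sum1 sum2 sum3 by (simp only: sum.distrib sum_delta_23 sum_delta_13 sum_delta_12)
    finally show "(\<Sum>j\<in>UNIV. D3 $ i $ j * V (\<xi> j)) = partial_deriv 3 V (\<xi> i)"
      unfolding chain \<xi>i u inverse_jacobian .
  qed

  \<comment> \<open>Interpolation and extrapolation to the facet nodes\<close>
  have interp: "R \<zeta> *v nodal_values \<xi> V = nodal_values (\<xi>f \<zeta>) V"
    if V: "V \<in> poly_space q" and \<zeta>: "\<zeta> \<in> {1..4}" for V \<zeta>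
  proof -
    have "(R \<zeta> *v nodal_values \<xi> V) $ f = nodal_values (\<xi>f \<zeta>) V $ f" for f
    proof -
      obtain i j where f: "i \<le> qf1" "j \<le> qf2" "f = \<sigma>f (i, j)" using indexf by blast
      let ?I = "\<lambda>x y z. \<Sum>a=0..q1. \<Sum>b=0..q2. \<Sum>c=0..q3. lagrange_basis q1 \<eta>1 a x
        * lagrange_basis q2 \<eta>2 b y * lagrange_basis q3 \<eta>3 c z * V (collapsed_map (\<eta>1 a) (\<eta>2 b) (\<eta>3 c))"
      \<comment> \<open>The interpolant reproduces \<open>V\<close> at arbitrary arguments, hence
        also at facet nodes, which need not be volume nodes.\<close>
      have I: "?I x y z = V (collapsed_map x y z)" for x y z
        by (rule tensor_interpolation[where F = "\<lambda>x y z. V (collapsed_map x y z)",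
              OF nodes_distinct pf[OF V]])
      have sum: "(R \<zeta> *v nodal_values \<xi> V) $ f = (\<Sum>a=0..q1. \<Sum>b=0..q2. \<Sum>c=0..q3.
          R \<zeta> $ f $ \<sigma> (a, b, c) * V (collapsed_map (\<eta>1 a) (\<eta>2 b) (\<eta>3 c)))"
        by (simp add: matrix_vector_mult_def nodal_values_def reindex \<xi> Imem)
      have "\<zeta> = 1 \<or> \<zeta> = 2 \<or> \<zeta> = 3 \<or> \<zeta> = 4" using \<zeta> by auto
      then show ?thesis
      proof (elim disjE)
        assume \<zeta>: "\<zeta> = 1"
        have "(R \<zeta> *v nodal_values \<xi> V) $ f = ?I (\<eta>f1 i) (-1) (\<eta>f2 j)"
          unfolding sum unfolding f(3) \<zeta> using f(1,2) by (simp add: R(1) Imem Ifmem del: One_nat_def)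
        then show ?thesis using f \<xi>f(1)[of i j] by (simp add: I Ifmem nodal_values_def \<zeta> del: One_nat_def)
      next
        assume \<zeta>: "\<zeta> = 2"
        have "(R \<zeta> *v nodal_values \<xi> V) $ f = ?I 1 (\<eta>f1 i) (\<eta>f2 j)"
          unfolding sum unfolding f(3) \<zeta> using f(1,2) by (simp add: R(2) Imem Ifmem del: One_nat_def)
        then show ?thesis using f \<xi>f(2)[of i j] by (simp add: I Ifmem nodal_values_def \<zeta> del: One_nat_def)
      next
        assume \<zeta>: "\<zeta> = 3"
        have "(R \<zeta> *v nodal_values \<xi> V) $ f = ?I (-1) (\<eta>f1 i) (\<eta>f2 j)"
          unfolding sum unfolding f(3) \<zeta> using f(1,2) by (simp add: R(3) Imem Ifmem del: One_nat_def)
        then show ?thesis using f \<xi>f(3)[of i j] by (simp add: I Ifmem nodal_values_def \<zeta> del: One_nat_def)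
      next
        assume \<zeta>: "\<zeta> = 4"
        have "(R \<zeta> *v nodal_values \<xi> V) $ f = ?I (\<eta>f1 i) (\<eta>f2 j) (-1)"
          unfolding sum unfolding f(3) \<zeta> using f(1,2) by (simp add: R(4) Imem Ifmem del: One_nat_def)
        then show ?thesis using f \<xi>f(4)[of i j] by (simp add: I Ifmem nodal_values_def \<zeta> del: One_nat_def)
      qed
    qed
    then show ?thesis by (simp add: vec_eq_iff)
  qed

  have four: "(\<Sum>\<zeta>=1..4. h \<zeta>) = h 1 + h 2 + h 3 + h 4" for h :: "nat \<Rightarrow> real"
  proof -
    have "{1..4} = {1, 2, 3, 4 :: nat}" by auto
    then show ?thesis by simp
  qed
  have Bd: "B \<zeta> = (\<chi> i j. \<omega>f \<zeta> i * of_bool (i = j))" if "\<zeta> \<in> {1..4}" for \<zeta>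
    using B[OF that] .

  \<comment> \<open>Accuracy of the boundary operators\<close>
  have bdry: "nodal_values \<xi> U \<bullet> (E m *v nodal_values \<xi> V)
      = boundary_integral reference_tetrahedron m (\<lambda>x. U x * V x)"
    if U: "U \<in> poly_space q" and V: "V \<in> poly_space q" for U V m
  proof -
    define g where "g = (\<lambda>x. U x * V x)"
    have quad: "(\<Sum>f\<in>UNIV. \<omega>f \<zeta> f * g (\<xi>f \<zeta> f)) = c \<zeta> * collapsed_integral F"
      if \<zeta>: "\<zeta> \<in> {1..4}" and F: "\<And>i j. i \<le> qf1 \<Longrightarrow> j \<le> qf2 \<Longrightarrow> g (\<xi>f \<zeta> (\<sigma>f (i, j))) = F (\<eta>f1 i) (\<eta>f2 j)"
        and F1: "\<And>y. polyfun (q + q) (\<lambda>x. F x y)" and F2: "\<And>x. polyfun (q + q) (\<lambda>y. F x y)" for \<zeta> F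
    proof -
      have "(\<Sum>f\<in>UNIV. \<omega>f \<zeta> f * g (\<xi>f \<zeta> f))
          = c \<zeta> / 2 * (\<Sum>i=0..qf1. \<Sum>j=0..qf2. F (\<eta>f1 i) (\<eta>f2 j) * (\<omega>f1 i * wf2 j))"
        unfolding reindexf sum_distrib_left
        by (intro sum.cong refl) (simp add: wtf \<zeta>[simplified] F)
      also have "(\<Sum>i=0..qf1. \<Sum>j=0..qf2. F (\<eta>f1 i) (\<eta>f2 j) * (\<omega>f1 i * wf2 j))
          = 2 * collapsed_integral F"
        \<comment> \<open>The product of two polynomials has degree \<open>q + q\<close> in each
          variable, and \<open>q\<close> is at most each of \<open>q1\<close>, \<open>q2\<close>,
          \<open>q3\<close>.\<close>
        by (rule collapsed_quadrature[OF rf1 rf2])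
           (use qle in \<open>auto intro: polyfun_mono[OF F1] polyfun_mono[OF F2]\<close>)
      finally show ?thesis by simp
    qed
    note pg = polyfun_mult[OF polyfun_collapsed_map(1)[OF U] polyfun_collapsed_map(1)[OF V]]
      polyfun_mult[OF polyfun_collapsed_map(2)[OF U] polyfun_collapsed_map(2)[OF V]]
      polyfun_mult[OF polyfun_collapsed_map(3)[OF U] polyfun_collapsed_map(3)[OF V]]
    have quads: "(\<Sum>f\<in>UNIV. \<omega>f 1 f * g (\<xi>f 1 f)) = collapsed_integral (\<lambda>x y. g (collapsed_map x (-1) y))"
      "(\<Sum>f\<in>UNIV. \<omega>f 2 f * g (\<xi>f 2 f)) = sqrt 3 * collapsed_integral (\<lambda>x y. g (collapsed_map 1 x y))"
      "(\<Sum>f\<in>UNIV. \<omega>f 3 f * g (\<xi>f 3 f)) = collapsed_integral (\<lambda>x y. g (collapsed_map (-1) x y))"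
      "(\<Sum>f\<in>UNIV. \<omega>f 4 f * g (\<xi>f 4 f)) = collapsed_integral (\<lambda>x y. g (collapsed_map x y (-1)))"
         apply (subst quad[where F = "\<lambda>x y. g (collapsed_map x (-1) y)"]; simp add: \<xi>f Ifmem c g_def pg del: One_nat_def)
        apply (subst quad[where F = "\<lambda>x y. g (collapsed_map 1 x y)"]; simp add: \<xi>f Ifmem c g_def pg del: One_nat_def)
       apply (subst quad[where F = "\<lambda>x y. g (collapsed_map (-1) x y)"]; simp add: \<xi>f Ifmem c g_def pg del: One_nat_def)
      apply (subst quad[where F = "\<lambda>x y. g (collapsed_map x y (-1))"]; simp add: \<xi>f Ifmem c g_def pg del: One_nat_def)
      done
    have "nodal_values \<xi> U \<bullet> (E m *v nodal_values \<xi> V)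
        = (\<Sum>\<zeta>=1..4. facet_normal \<zeta> $ m * (nodal_values \<xi> U \<bullet>
            ((transpose (R \<zeta>) ** B \<zeta> ** R \<zeta>) *v nodal_values \<xi> V)))"
      unfolding E by (simp add: sum_matrix_vector_mult inner_sum_right flip: scaleR_matrix_vector_assoc)
    also have "\<dots> = (\<Sum>\<zeta>=1..4. facet_normal \<zeta> $ m * (\<Sum>f\<in>UNIV. \<omega>f \<zeta> f * g (\<xi>f \<zeta> f)))"
      by (intro sum.cong refl)
         (simp add: diag_sandwich_inner[OF Bd] interp[OF U] interp[OF V], simp add: nodal_values_def g_def)
    also have "\<dots> = boundary_integral reference_tetrahedron m g"
      unfolding four quads
      by (subst boundary_integral_tetrahedron)
         (auto simp: g_def intro!: continuous_intros poly_space_continuous[OF U] poly_space_continuous[OF V])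
    finally show ?thesis by (simp add: g_def)
  qed

  \<comment> \<open>One-dimensional mass matrices and summation by parts\<close>
  define m1 where "m1 = lagrange_gram q1 \<eta>1 1"
  define m2 where "m2 = lagrange_gram q2 \<eta>2 1"
  define k2 where "k2 = lagrange_gram q2 \<eta>2 [:1, -1:]"
  define k3 where "k3 = lagrange_gram q3 \<eta>3 [:1, -1:]"
  define L1 where "L1 = lagrange_basis q1 \<eta>1"
  define L2 where "L2 = lagrange_basis q2 \<eta>2"
  define L3 where "L3 = lagrange_basis q3 \<eta>3"
  \<comment> \<open>The degrees needed are \<open>2 * q1\<close> for \<open>m1\<close>,
    \<open>2 * q2\<close> for \<open>m2\<close>, \<open>2 * q2 + 1\<close> for \<open>k2\<close>
    because of the factor \<open>1 - \<eta>2\<close>, and \<open>2 * q3\<close> for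
    \<open>k3\<close>, whose factor \<open>1 - \<eta>3\<close> is already the weight of the
    rule.\<close>
  have diag1: "\<omega>1 a * of_bool (a = a') = m1 a a'" if "a \<le> q1" "a' \<le> q1" for a a'
    using lagrange_gram_diag[OF r1 nodes_distinct(1) that, of 1] by (simp add: m1_def)
  have diag2: "\<omega>2 b * of_bool (b = b') = m2 b b'"
    "(1 - \<eta>2 b) * \<omega>2 b * of_bool (b = b') = k2 b b'" if "b \<le> q2" "b' \<le> q2" for b b'
    using lagrange_gram_diag[OF r2 nodes_distinct(2) that, of 1]
      lagrange_gram_diag[OF r2 nodes_distinct(2) that, of "[:1, -1:]"] by (simp_all add: m2_def k2_def)
  have diag3: "w3 c * of_bool (c = c') = k3 c c'" if "c \<le> q3" "c' \<le> q3" for c c'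
    using lagrange_gram_diag[OF r3 nodes_distinct(3) that, of 1] by (simp add: k3_def)
  have sym: "m1 a' a = m1 a a'" "m2 a' a = m2 a a'" "k2 a' a = k2 a a'" "k3 a' a = k3 a a'" for a a'
    by (simp_all add: m1_def m2_def k2_def k3_def lagrange_gram_sym)
  \<comment> \<open>Here \<open>g\<close> is 1 and then 1 + x. The latter vanishes at -1, equals 2
    at 1, and has derivative 1, which leaves \<open>m1\<close>.\<close>
  have sbp1: "\<omega>1 a * deriv (L1 a') (\<eta>1 a) + \<omega>1 a' * deriv (L1 a) (\<eta>1 a')
        = L1 a 1 * L1 a' 1 - L1 a (-1) * L1 a' (-1)"
    "(1 + \<eta>1 a) * \<omega>1 a * deriv (L1 a') (\<eta>1 a) + (1 + \<eta>1 a') * \<omega>1 a' * deriv (L1 a) (\<eta>1 a')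
        = 2 * L1 a 1 * L1 a' 1 - m1 a a'" if "a \<le> q1" "a' \<le> q1" for a a'
    using lagrange_sbp[OF r1 nodes_distinct(1) that, of 1]
      lagrange_sbp[OF r1 nodes_distinct(1) that, of "[:1, 1:]"]
    by (simp_all add: L1_def m1_def lagrange_gram_0 pderiv_pCons flip: one_pCons)
  have sbp2: "(1 - \<eta>2 b) * \<omega>2 b * deriv (L2 b') (\<eta>2 b) + (1 - \<eta>2 b') * \<omega>2 b' * deriv (L2 b) (\<eta>2 b')
        = m2 b b' - 2 * L2 b (-1) * L2 b' (-1)"
    "(1 - \<eta>2 b) * (1 + \<eta>2 b) * \<omega>2 b * deriv (L2 b') (\<eta>2 b)
        + (1 - \<eta>2 b') * (1 + \<eta>2 b') * \<omega>2 b' * deriv (L2 b) (\<eta>2 b')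
        = 2 * (m2 b b' - k2 b b')" if "b \<le> q2" "b' \<le> q2" for b b'
  proof -
    have "pderiv [:1, -1 :: real:] = smult (-1) 1" by (simp add: pderiv_pCons one_pCons)
    then have "lagrange_gram q2 \<eta>2 (pderiv [:1, -1:]) b b' = - m2 b b'"
      by (simp only: lagrange_gram_smult m2_def)
    then show "(1 - \<eta>2 b) * \<omega>2 b * deriv (L2 b') (\<eta>2 b) + (1 - \<eta>2 b') * \<omega>2 b' * deriv (L2 b) (\<eta>2 b')
        = m2 b b' - 2 * L2 b (-1) * L2 b' (-1)"
      using lagrange_sbp[OF r2 nodes_distinct(2) that, of "[:1, -1:]"]
      by (simp add: L2_def del: pderiv.simps)
    \<comment> \<open>The polynomial is 1 - y^2, which vanishes at both ends, so no boundary term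
      arises. Its derivative -2y is split as 2(1 - y) - 2, so that only \<open>k2\<close> and
      \<open>m2\<close> occur.\<close>
    have "pderiv [:1, 0, -1 :: real:] = smult 2 [:1, -1:] + smult (-2) 1"
      by (simp add: pderiv_pCons one_pCons)
    then have "lagrange_gram q2 \<eta>2 (pderiv [:1, 0, -1:]) b b' = 2 * k2 b b' - 2 * m2 b b'"
      by (simp only: lagrange_gram_add lagrange_gram_smult m2_def k2_def)
    then show "(1 - \<eta>2 b) * (1 + \<eta>2 b) * \<omega>2 b * deriv (L2 b') (\<eta>2 b)
        + (1 - \<eta>2 b') * (1 + \<eta>2 b') * \<omega>2 b' * deriv (L2 b) (\<eta>2 b')
        = 2 * (m2 b b' - k2 b b')"
      using lagrange_sbp[OF r2 nodes_distinct(2) that, of "[:1, 0, -1:]"]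
      by (simp add: L2_def algebra_simps)
  qed
  have sbp3: "(1 - \<eta>3 c) * w3 c * deriv (L3 c') (\<eta>3 c) + (1 - \<eta>3 c') * w3 c' * deriv (L3 c) (\<eta>3 c')
        = 2 * k3 c c' - 4 * L3 c (-1) * L3 c' (-1)" if "c \<le> q3" "c' \<le> q3" for c c'
  proof -
    \<comment> \<open>Together with the weight of the rule, the factor \<open>g\<close> makes (1 -
      z)^2, which equals 4 at -1; its derivative is again a multiple of the weight.\<close>
    have "pderiv ([:1, -1 :: real:] * [:1, -1:]) = smult (-2) [:1, -1:]" by (simp add: pderiv_pCons)
    then have "lagrange_gram q3 \<eta>3 (pderiv ([:1, -1:] * [:1, -1:])) c c' = - 2 * k3 c c'"
      by (simp only: lagrange_gram_smult k3_def)
    then show ?thesis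
      using lagrange_sbp[OF r3 nodes_distinct(3) that, of "[:1, -1:]"]
      by (simp add: L3_def algebra_simps del: mult_pCons_left mult_pCons_right)
  qed

  \<comment> \<open>The first facet coordinate is \<open>\<eta>1\<close> or \<open>\<eta>2\<close>
    and the second \<open>\<eta>2\<close> or \<open>\<eta>3\<close>, depending on the facet; hence
    the maxima in the exactness assumptions. The facet sums thus give the same mass matrices as the
    volume rules.\<close>
  note gramf = lagrange_gram_sum[OF rf1, of q1 _ _ \<eta>1, folded L1_def m1_def, simplified]
    lagrange_gram_sum[OF rf1, of q2 _ _ \<eta>2, folded L2_def m2_def, simplified]
    lagrange_gram_sum[OF rf2, of q2 _ _ \<eta>2, folded L2_def k2_def, simplified]
    lagrange_gram_sum[OF rf2, of q3 _ _ \<eta>3, folded L3_def k3_def, simplified]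

  \<comment> \<open>Entries of the boundary operators\<close>
  have E_entry: "E m $ \<sigma> (a, b, c') $ \<sigma> (a', b', c'') =
      1/2 * (facet_normal 1 $ m * (m1 a a' * (L2 b (-1) * L2 b' (-1)) * k3 c' c'')
        + sqrt 3 * facet_normal 2 $ m * (L1 a 1 * L1 a' 1 * m2 b b' * k3 c' c'')
        + facet_normal 3 $ m * (L1 a (-1) * L1 a' (-1) * m2 b b' * k3 c' c'')
        + facet_normal 4 $ m * (m1 a a' * k2 b b' * (L3 c' (-1) * L3 c'' (-1))))"
    if i: "a \<le> q1" "b \<le> q2" "c' \<le> q3" and j: "a' \<le> q1" "b' \<le> q2" "c'' \<le> q3" for m a b c' a' b' c''
  proof -
    let ?i = "\<sigma> (a, b, c')" and ?j = "\<sigma> (a', b', c'')"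
    define G where "G = (\<lambda>\<zeta>. \<Sum>f\<in>UNIV. \<omega>f \<zeta> f * (R \<zeta> $ f $ ?i * R \<zeta> $ f $ ?j))"
    have "E m $ ?i $ ?j = (\<Sum>\<zeta>=1..4. facet_normal \<zeta> $ m * G \<zeta>)"
      unfolding E by (auto simp: G_def diag_sandwich_nth[OF Bd] intro!: sum.cong)
    moreover have "G 1 = 1/2 * (L2 b (-1) * L2 b' (-1)) * (m1 a a' * k3 c' c'')"
    proof -
      have "G 1 = 1/2 * (L2 b (-1) * L2 b' (-1))
          * ((\<Sum>x=0..qf1. L1 a (\<eta>f1 x) * L1 a' (\<eta>f1 x) * \<omega>f1 x)
           * (\<Sum>y=0..qf2. L3 c' (\<eta>f2 y) * L3 c'' (\<eta>f2 y) * wf2 y))"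
        unfolding G_def reindexf
        by (rule sum_product_eq) (use i j in \<open>simp add: wtf c R(1) Imem Ifmem L1_def L2_def L3_def del: One_nat_def\<close>)
      then show ?thesis using i j by (simp add: gramf)
    qed
    moreover have "G 2 = sqrt 3/2 * (L1 a 1 * L1 a' 1) * (m2 b b' * k3 c' c'')"
    proof -
      have "G 2 = sqrt 3/2 * (L1 a 1 * L1 a' 1)
          * ((\<Sum>x=0..qf1. L2 b (\<eta>f1 x) * L2 b' (\<eta>f1 x) * \<omega>f1 x)
           * (\<Sum>y=0..qf2. L3 c' (\<eta>f2 y) * L3 c'' (\<eta>f2 y) * wf2 y))"
        unfolding G_def reindexf
        by (rule sum_product_eq) (use i j in \<open>simp add: wtf c R(2) Imem Ifmem L1_def L2_def L3_def del: One_nat_def\<close>)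
      then show ?thesis using i j by (simp add: gramf)
    qed
    moreover have "G 3 = 1/2 * (L1 a (-1) * L1 a' (-1)) * (m2 b b' * k3 c' c'')"
    proof -
      have "G 3 = 1/2 * (L1 a (-1) * L1 a' (-1))
          * ((\<Sum>x=0..qf1. L2 b (\<eta>f1 x) * L2 b' (\<eta>f1 x) * \<omega>f1 x)
           * (\<Sum>y=0..qf2. L3 c' (\<eta>f2 y) * L3 c'' (\<eta>f2 y) * wf2 y))"
        unfolding G_def reindexf
        by (rule sum_product_eq) (use i j in \<open>simp add: wtf c R(3) Imem Ifmem L1_def L2_def L3_def del: One_nat_def\<close>)
      then show ?thesis using i j by (simp add: gramf)
    qed
    \<comment> \<open>On this facet the second coordinate is \<open>\<eta>2\<close>, so the weight
      belongs to direction 2 and \<open>k2\<close> takes the place of \<open>m2\<close>.\<close>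
    moreover have "G 4 = 1/2 * (L3 c' (-1) * L3 c'' (-1)) * (m1 a a' * k2 b b')"
    proof -
      have "G 4 = 1/2 * (L3 c' (-1) * L3 c'' (-1))
          * ((\<Sum>x=0..qf1. L1 a (\<eta>f1 x) * L1 a' (\<eta>f1 x) * \<omega>f1 x)
           * (\<Sum>y=0..qf2. L2 b (\<eta>f2 y) * L2 b' (\<eta>f2 y) * wf2 y))"
        unfolding G_def reindexf
        by (rule sum_product_eq) (use i j in \<open>simp add: wtf c R(4) Imem Ifmem L1_def L2_def L3_def del: One_nat_def\<close>)
      then show ?thesis using i j by (simp add: gramf)
    qed
    ultimately show ?thesis unfolding four by (simp add: algebra_simps)
  qed

  \<comment> \<open>Entries of \<open>W ** D\<close> without denominators\<close>
  have entry1: "\<omega> (\<sigma> (a, b, c')) * D1 $ \<sigma> (a, b, c') $ \<sigma> (a', b', c'')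
      = 1/2 * (\<omega>1 a * deriv (L1 a') (\<eta>1 a)) * m2 b b' * k3 c' c''"
    and entry2: "\<omega> (\<sigma> (a, b, c')) * D2 $ \<sigma> (a, b, c') $ \<sigma> (a', b', c'')
      = 1/4 * ((1 + \<eta>1 a) * \<omega>1 a * deriv (L1 a') (\<eta>1 a)) * m2 b b' * k3 c' c''
        + 1/4 * m1 a a' * ((1 - \<eta>2 b) * \<omega>2 b * deriv (L2 b') (\<eta>2 b)) * k3 c' c''"
    and entry3: "\<omega> (\<sigma> (a, b, c')) * D3 $ \<sigma> (a, b, c') $ \<sigma> (a', b', c'')
      = 1/4 * ((1 + \<eta>1 a) * \<omega>1 a * deriv (L1 a') (\<eta>1 a)) * m2 b b' * k3 c' c''
        + 1/8 * m1 a a' * ((1 - \<eta>2 b) * (1 + \<eta>2 b) * \<omega>2 b * deriv (L2 b') (\<eta>2 b)) * k3 c' c''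
        + 1/8 * m1 a a' * k2 b b' * ((1 - \<eta>3 c') * w3 c' * deriv (L3 c'') (\<eta>3 c'))"
    if i: "a \<le> q1" "b \<le> q2" "c' \<le> q3" and j: "a' \<le> q1" "b' \<le> q2" "c'' \<le> q3" for a b c' a' b' c''
  proof -
    have mem: "(a, b, c') \<in> I" "(a', b', c'') \<in> I" using i j by (simp_all add: Imem)
    note nz' = nz(1,2)[OF i(2,3)]
    note diags = diag1[OF i(1) j(1)] diag2[OF i(2) j(2)] diag3[OF i(3) j(3)]
    show "\<omega> (\<sigma> (a, b, c')) * D1 $ \<sigma> (a, b, c') $ \<sigma> (a', b', c'')
      = 1/2 * (\<omega>1 a * deriv (L1 a') (\<eta>1 a)) * m2 b b' * k3 c' c''"
      unfolding wt[OF i] D1[OF mem] weighted_entry_1[OF nz'] diags L1_def ..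
    show "\<omega> (\<sigma> (a, b, c')) * D2 $ \<sigma> (a, b, c') $ \<sigma> (a', b', c'')
      = 1/4 * ((1 + \<eta>1 a) * \<omega>1 a * deriv (L1 a') (\<eta>1 a)) * m2 b b' * k3 c' c''
        + 1/4 * m1 a a' * ((1 - \<eta>2 b) * \<omega>2 b * deriv (L2 b') (\<eta>2 b)) * k3 c' c''"
      unfolding wt[OF i] D2[OF mem] weighted_entry_2[OF nz'] diags L1_def L2_def ..
    show "\<omega> (\<sigma> (a, b, c')) * D3 $ \<sigma> (a, b, c') $ \<sigma> (a', b', c'')
      = 1/4 * ((1 + \<eta>1 a) * \<omega>1 a * deriv (L1 a') (\<eta>1 a)) * m2 b b' * k3 c' c''
        + 1/8 * m1 a a' * ((1 - \<eta>2 b) * (1 + \<eta>2 b) * \<omega>2 b * deriv (L2 b') (\<eta>2 b)) * k3 c' c''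
        + 1/8 * m1 a a' * k2 b b' * ((1 - \<eta>3 c') * w3 c' * deriv (L3 c'') (\<eta>3 c'))"
      unfolding wt[OF i] D3[OF mem] weighted_entry_3[OF nz'] diags L1_def L2_def L3_def ..
  qed

  \<comment> \<open>On the oblique facet the area factor \<open>sqrt 3\<close> cancels the
    normalization of the normal.\<close>
  have normals: "facet_normal 1 $ 1 = 0" "sqrt 3 * facet_normal 2 $ 1 = 1" "facet_normal 3 $ 1 = -1"
    "facet_normal 4 $ 1 = 0" "facet_normal 1 $ 2 = -1" "sqrt 3 * facet_normal 2 $ 2 = 1"
    "facet_normal 3 $ 2 = 0" "facet_normal 4 $ 2 = 0" "facet_normal 1 $ 3 = 0"
    "sqrt 3 * facet_normal 2 $ 3 = 1" "facet_normal 3 $ 3 = 0" "facet_normal 4 $ 3 = -1"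
    by (simp_all add: facet_normal_def)

  \<comment> \<open>The summation-by-parts identity, entry by entry\<close>
  have sbp: "\<omega> i * D1 $ i $ j + \<omega> j * D1 $ j $ i = E 1 $ i $ j"
    "\<omega> i * D2 $ i $ j + \<omega> j * D2 $ j $ i = E 2 $ i $ j"
    "\<omega> i * D3 $ i $ j + \<omega> j * D3 $ j $ i = E 3 $ i $ j" for i j
  proof -
    obtain a b c' where i: "a \<le> q1" "b \<le> q2" "c' \<le> q3" "i = \<sigma> (a, b, c')" using index by blast
    obtain a' b' c'' where j: "a' \<le> q1" "b' \<le> q2" "c'' \<le> q3" "j = \<sigma> (a', b', c'')" using index by blast
    note syms = sym(1)[of a' a] sym(2)[of b' b] sym(3)[of b' b] sym(4)[of c'' c']
    note s1 = sbp1[OF i(1) j(1)] and s2 = sbp2[OF i(2) j(2)] and s3 = sbp3[OF i(3) j(3)]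
    show "\<omega> i * D1 $ i $ j + \<omega> j * D1 $ j $ i = E 1 $ i $ j"
      unfolding i(4) j(4) entry1[OF i(1-3) j(1-3)] entry1[OF j(1-3) i(1-3)]
        E_entry[OF i(1-3) j(1-3)] syms normals
      using s1 by algebra
    \<comment> \<open>The terms \<open>m1 * m2 * k3\<close> cancel: direction 1 contributes -1/4 of
      it and direction 2 contributes +1/4.\<close>
    show "\<omega> i * D2 $ i $ j + \<omega> j * D2 $ j $ i = E 2 $ i $ j"
      unfolding i(4) j(4) entry2[OF i(1-3) j(1-3)] entry2[OF j(1-3) i(1-3)]
        E_entry[OF i(1-3) j(1-3)] syms normals
      using s1 s2 by algebra
    \<comment> \<open>Two cancellations in a chain: \<open>m1 * m2 * k3\<close> between directions 1
      and 2, and \<open>m1 * k2 * k3\<close> between directions 2 and 3, each with coefficients -1/4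
      and +1/4. Only the facets 2 and 4 remain.\<close>
    show "\<omega> i * D3 $ i $ j + \<omega> j * D3 $ j $ i = E 3 $ i $ j"
      unfolding i(4) j(4) entry3[OF i(1-3) j(1-3)] entry3[OF j(1-3) i(1-3)]
        E_entry[OF i(1-3) j(1-3)] syms normals
      using s1 s2 s3 by algebra
  qed

  note SBP = diagonal_norm_SBP_operatorI[OF polytope_reference_tetrahedron interior_reference_tetrahedron
      inj_\<xi> range_\<xi> wpos W]
  have "diagonal_norm_nodal_SBP_operator reference_tetrahedron \<xi> 1 q D1 W (E 1)"
    by (rule SBP[OF deriv1 sbp(1) bdry])
  moreover have "diagonal_norm_nodal_SBP_operator reference_tetrahedron \<xi> 2 q D2 W (E 2)"
    by (rule SBP[OF deriv2 sbp(2) bdry])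
  moreover have "diagonal_norm_nodal_SBP_operator reference_tetrahedron \<xi> 3 q D3 W (E 3)"
    by (rule SBP[OF deriv3 sbp(3) bdry])
  moreover have "\<forall>\<zeta>\<in>{1..4}. \<exists>r\<ge>q. interp_extrap_operator \<xi> (\<xi>f \<zeta>) r (R \<zeta>)"
    unfolding interp_extrap_operator_def using interp by blast
  ultimately show ?thesis by blast
qed

end
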